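(* Let $(\mathcal{A}, \mathcal{B})$ be a recovering pair over a ground set $X$ of size $n$, and let $\alpha = 0.27$ and $\theta = 2.222$. Then $$|\mathcal{A}|\,|\mathcal{B}| \leq \max\left\{2.2499,\ \theta^{\alpha} \cdot \mu_{\mathrm{can}}^{1-\alpha}\right\}^n.$$ In particular, $\mu_{\mathrm{rec}} < \mu_{\mathrm{can}}$.
   Context: For a set $X$, let $2^X$ denote the family of all subsets of $X$, and let $[n] = \{1,\dots,n\}$. Let $\mathcal{A}, \mathcal{B} \subseteq 2^X$. The pair $(\mathcal{A}, \mathcal{B})$ is a recovering pair over $X$ if for all $A, A' \in \mathcal{A}$ and all $B, B' \in \mathcal{B}$: $A \setminus B = A' \setminus B'$ implies $A = A'$, and $B \setminus A = B' \setminus A'$ implies $B = B'$. The pair $(\mathcal{A}, \mathcal{B})$ is a cancellative pair over $X$ if for all $A, A' \in \mathcal{A}$ and all $B, B' \in \mathcal{B}$: $A \setminus B = A' \setminus B$ implies $A = A'$, and $B \setminus A = B' \setminus A$ implies $B = B'$. The optimal rates are $$\mu_{\mathrm{rec}} := \lim_{n \to \infty} \max\left\{ (|\mathcal{A}||\mathcal{B}|)^{1/n} : (\mathcal{A},\mathcal{B}) \text{ is a recovering pair over } [n]\right\},$$ $$\mu_{\mathrm{can}} := \lim_{n \to \infty} \max\left\{ (|\mathcal{A}||\mathcal{B}|)^{1/n} : (\mathcal{A},\mathcal{B}) \text{ is a cancellative pair over } [n]\right\}.$$ Both limits exist, by supermultiplicativity of the maxima of $|\mathcal{A}||\mathcal{B}|$.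 *)

theory Defs
  imports Complex_Main
begin

definition recovering_pair :: "'a set \<Rightarrow> 'a set set \<Rightarrow> 'a set set \<Rightarrow> bool" where
  "recovering_pair X \<A> \<B> \<longleftrightarrow>
     \<A> \<subseteq> Pow X \<and> \<B> \<subseteq> Pow X \<and>
     (\<forall>A\<in>\<A>. \<forall>A'\<in>\<A>. \<forall>B\<in>\<B>. \<forall>B'\<in>\<B>.
        (A - B = A' - B' \<longrightarrow> A = A') \<and> (B - A = B' - A' \<longrightarrow> B = B'))"

definition cancellative_pair :: "'a set \<Rightarrow> 'a set set \<Rightarrow> 'a set set \<Rightarrow> bool" where
  "cancellative_pair X \<A> \<B> \<longleftrightarrow>
     \<A> \<subseteq> Pow X \<and> \<B> \<subseteq> Pow X \<and>
     (\<forall>A\<in>\<A>. \<forall>A'\<in>\<A>. \<forall>B\<in>\<B>. \<forall>B'\<in>\<B>.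
        (A - B = A' - B \<longrightarrow> A = A') \<and> (B - A = B' - A \<longrightarrow> B = B'))"

text \<open>
  In both rates the set under \<open>Max\<close> is finite and nonempty, and the limits exist because the
  maxima of \<open>card \<A> * card \<B>\<close> are supermultiplicative in \<open>n\<close>.  The term at \<open>n = 0\<close>,
  where \<open>1 / 0 = 0\<close>, does not affect the limits.
\<close>

definition mu_rec :: real where
  "mu_rec = lim (\<lambda>n::nat.
     Max {real (card \<A> * card \<B>) powr (1 / real n) | \<A> \<B>. recovering_pair {1..n} \<A> \<B>})"

definition mu_can :: real where
  "mu_can = lim (\<lambda>n::nat.
     Max {real (card \<A> * card \<B>) powr (1 / real n) | \<A> \<B>. cancellative_pair {1..n} \<A> \<B>})"

end

theory Submission
  imports Defs "HOL-Analysis.Convex"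
begin

text \<open>
  In fact \<open>card \<A> * card \<B> \<le> 2.2499 ^ n\<close> for every recovering pair, while \<open>mu_can \<ge> 9/4\<close>.

  Let \<open>A\<close>, \<open>B\<close> be independent and uniform on \<open>\<A>\<close>, \<open>\<B>\<close>, with marginals \<open>p i\<close> and \<open>q i\<close>. As \<open>A - B\<close>
  determines \<open>A\<close>, we get \<open>H(A - B) = log |\<A>| + H(A \<inter> B | A)\<close>. With an independent copy \<open>A'\<close> of \<open>A\<close>,
  \<open>H(A \<inter> B | A) \<ge> H(B \<inter> (A - A') | A, A')\<close>; since \<open>B - A'\<close> determines \<open>B\<close>, the chain rule inside
  \<open>X - A'\<close> bounds this below by \<open>\<Sum>i. p i * V i\<close>, where \<open>\<Sum>i. V i = log |\<B>|\<close> and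
  \<open>V i \<le> (1 - p i) * h (q i)\<close>. Subadditivity of \<open>H(A - B)\<close> and the same argument with the roles
  exchanged leave an inequality between entropies of two real numbers.

  For the lower bound on \<open>mu_can\<close>, intersect the \<open>w\<close>-subsets of \<open>{1..n}\<close> with a coset of a random binary
  linear code of codimension \<open>w + 1\<close> and discard those containing the support of a nonzero
  codeword. Each remaining \<open>B\<close> can be cancelled, because \<open>A - B = A' - B\<close> forces the codeword
  \<open>A + A'\<close> to be supported in \<open>B\<close>.
\<close>

section \<open>Entropy of the traces of a random set\<close>

definition bin_entropy :: "real \<Rightarrow> real" where
  "bin_entropy x = - (x * log 2 x + (1 - x) * log 2 (1 - x))"

text \<open>\<open>\<Omega>\<close> stands for a uniform sample space and \<open>s\<close> for a
  random set on it; this is the fibre of \<open>\<omega>\<close> under the trace on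
  \<open>W\<close>.\<close>

definition agreeing :: "'b set \<Rightarrow> ('b \<Rightarrow> 'a set) \<Rightarrow> 'a set \<Rightarrow> 'b \<Rightarrow> 'b set" where
  "agreeing \<Omega> s W \<omega> = {\<omega>' \<in> \<Omega>. s \<omega>' \<inter> W = s \<omega> \<inter> W}"

text \<open>The Shannon entropy in bits of the trace on \<open>W\<close>, written as the mean
  surprisal over outcomes instead of a sum over values.\<close>

definition trace_entropy :: "'b set \<Rightarrow> ('b \<Rightarrow> 'a set) \<Rightarrow> 'a set \<Rightarrow> real" where
  "trace_entropy \<Omega> s W = (\<Sum>\<omega>\<in>\<Omega>. log 2 (card \<Omega> / card (agreeing \<Omega> s W \<omega>))) / card \<Omega>"

lemma card_agreeing_pos:
  assumes "finite \<Omega>" "\<omega> \<in> \<Omega>"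
  shows "0 < card (agreeing \<Omega> s W \<omega>)"
  using assms by (auto simp: agreeing_def card_gt_0_iff)

lemma trace_entropy_empty [simp]: "trace_entropy \<Omega> s {} = 0"
proof -
  have "log 2 (card \<Omega> / card (agreeing \<Omega> s {} \<omega>)) = 0" if "\<omega> \<in> \<Omega>" for \<omega>
    using that by (cases "card \<Omega> = 0") (auto simp: agreeing_def log_def)
  then show ?thesis by (simp add: trace_entropy_def)
qed

lemma trace_entropy_mono:
  assumes "finite \<Omega>" "U \<subseteq> W"
  shows "trace_entropy \<Omega> s U \<le> trace_entropy \<Omega> s W"
  unfolding trace_entropy_def
proof (intro divide_right_mono sum_mono)
  fix \<omega> assume w: "\<omega> \<in> \<Omega>"
  have "agreeing \<Omega> s W \<omega> \<subseteq> agreeing \<Omega> s U \<omega>"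
    using assms(2) by (fastforce simp: agreeing_def)
  then have "card (agreeing \<Omega> s W \<omega>) \<le> card (agreeing \<Omega> s U \<omega>)"
    using assms(1) by (intro card_mono) (auto simp: agreeing_def)
  moreover have "0 < card \<Omega>" using assms(1) w by (auto simp: card_gt_0_iff)
  ultimately show "log 2 (card \<Omega> / card (agreeing \<Omega> s U \<omega>)) \<le> log 2 (card \<Omega> / card (agreeing \<Omega> s W \<omega>))"
    using card_agreeing_pos[OF assms(1) w, of s U] card_agreeing_pos[OF assms(1) w, of s W]
    by (subst log_le_cancel_iff) (auto intro!: divide_left_mono mult_pos_pos)
qed simp

text \<open>The difference is the conditional entropy of the bit \<open>i \<in> s \<omega>\<close>
  given the trace on \<open>W\<close>; each ratio is the reciprocal of the conditional probability
  of the observed bit.\<close>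

lemma trace_entropy_insert_diff:
  assumes "finite \<Omega>"
  shows "trace_entropy \<Omega> s (insert i W) - trace_entropy \<Omega> s W =
    (\<Sum>\<omega>\<in>\<Omega>. log 2 (card (agreeing \<Omega> s W \<omega>) / card (agreeing \<Omega> s (insert i W) \<omega>))) / card \<Omega>"
proof -
  have "log 2 (card \<Omega> / card (agreeing \<Omega> s (insert i W) \<omega>)) - log 2 (card \<Omega> / card (agreeing \<Omega> s W \<omega>))
      = log 2 (card (agreeing \<Omega> s W \<omega>) / card (agreeing \<Omega> s (insert i W) \<omega>))" if "\<omega> \<in> \<Omega>" for \<omega>
  proof -
    have "0 < card \<Omega>" using assms that by (auto simp: card_gt_0_iff)
    then show ?thesis
      using card_agreeing_pos[OF assms that, of s W] card_agreeing_pos[OF assms that, of s "insert i W"]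
      by (simp add: log_divide)
  qed
  then show ?thesis
    by (simp add: trace_entropy_def flip: diff_divide_distrib sum_subtractf)
qed

text \<open>Each summand is the conditional probability of the observed bit at \<open>i\<close>
  given the trace on \<open>U\<close>, divided by that given the trace on \<open>W\<close>. Averaged
  over a fibre of \<open>W\<close>, this leaves the sum of the former over the bits that occur in
  the fibre, which is at most 1.\<close>

lemma sum_agreeing_ratio_le:
  assumes fin: "finite \<Omega>" and UW: "U \<subseteq> W"
  shows "(\<Sum>\<omega>\<in>\<Omega>. (card (agreeing \<Omega> s W \<omega>) / card (agreeing \<Omega> s (insert i W) \<omega>)) /
                (card (agreeing \<Omega> s U \<omega>) / card (agreeing \<Omega> s (insert i U) \<omega>))) \<le> card \<Omega>"
proof -
  let ?N = "\<lambda>W \<omega>. real (card (agreeing \<Omega> s W \<omega>))"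
  have pos: "?N V \<omega> > 0" if "\<omega> \<in> \<Omega>" for V \<omega>
    using card_agreeing_pos[OF fin that] by simp
  have sub: "agreeing \<Omega> s W \<eta> \<subseteq> \<Omega>" for \<eta> by (auto simp: agreeing_def)
  have same: "?N U \<omega> = ?N U \<eta>" if "\<omega> \<in> agreeing \<Omega> s W \<eta>" for \<omega> \<eta>
  proof -
    have "s \<omega> \<inter> U = s \<eta> \<inter> U" using that UW by (fastforce simp: agreeing_def)
    then show ?thesis by (simp add: agreeing_def)
  qed
  have inner: "(\<Sum>\<omega>\<in>agreeing \<Omega> s W \<eta>. ?N (insert i U) \<omega> / ?N (insert i W) \<omega>) \<le> ?N U \<eta>"
    if \<eta>: "\<eta> \<in> \<Omega>" for \<eta>
  proof -
    define C where "C b = {\<omega> \<in> agreeing \<Omega> s W \<eta>. (i \<in> s \<omega>) = b}" for b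
    define D where "D b = {\<omega> \<in> agreeing \<Omega> s U \<eta>. (i \<in> s \<omega>) = b}" for b
    have finC: "finite (C b)" and finD: "finite (D b)" for b
      using fin by (auto simp: C_def D_def agreeing_def)
    have part: "(\<Sum>\<omega>\<in>C b. ?N (insert i U) \<omega> / ?N (insert i W) \<omega>) \<le> card (D b)" for b
    proof -
      have "agreeing \<Omega> s (insert i W) \<omega> = C b" "agreeing \<Omega> s (insert i U) \<omega> = D b"
        if "\<omega> \<in> C b" for \<omega>
        using that UW unfolding C_def D_def agreeing_def by auto
      then have "(\<Sum>\<omega>\<in>C b. ?N (insert i U) \<omega> / ?N (insert i W) \<omega>) =
          (\<Sum>\<omega>\<in>C b. real (card (D b)) / real (card (C b)))"
        by (intro sum.cong) auto
      also have "\<dots> \<le> card (D b)" by (cases "card (C b) = 0") auto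
      finally show ?thesis .
    qed
    have "agreeing \<Omega> s W \<eta> = C True \<union> C False" "C True \<inter> C False = {}"
      by (auto simp: C_def)
    then have "(\<Sum>\<omega>\<in>agreeing \<Omega> s W \<eta>. ?N (insert i U) \<omega> / ?N (insert i W) \<omega>) =
        (\<Sum>\<omega>\<in>C True. ?N (insert i U) \<omega> / ?N (insert i W) \<omega>) +
        (\<Sum>\<omega>\<in>C False. ?N (insert i U) \<omega> / ?N (insert i W) \<omega>)"
      using finC[of True] finC[of False] by (simp only: sum.union_disjoint)
    also have "\<dots> \<le> real (card (D True)) + real (card (D False))"
      by (intro add_mono part)
    also have "\<dots> = card (D True \<union> D False)"
      using finD[of True] finD[of False] by (subst card_Un_disjoint) (auto simp: D_def)
    also have "D True \<union> D False = agreeing \<Omega> s U \<eta>" by (auto simp: D_def)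
    finally show ?thesis .
  qed
  \<comment> \<open>The numerator \<open>?N W \<omega>\<close> becomes a sum over the
    \<open>\<eta>\<close> in the fibre of \<open>\<omega>\<close>. Sharing a fibre is symmetric, so
    swapping the sums groups the terms by fibre.\<close>
  have "(\<Sum>\<omega>\<in>\<Omega>. (?N W \<omega> / ?N (insert i W) \<omega>) / (?N U \<omega> / ?N (insert i U) \<omega>)) =
      (\<Sum>\<omega>\<in>\<Omega>. \<Sum>\<eta>\<in>agreeing \<Omega> s W \<omega>. ?N (insert i U) \<omega> / ?N (insert i W) \<omega> / ?N U \<omega>)"
    by (intro sum.cong) (auto simp: field_simps)
  also have "\<dots> = (\<Sum>\<omega>\<in>\<Omega>. \<Sum>\<eta> | \<eta> \<in> \<Omega> \<and> \<omega> \<in> agreeing \<Omega> s W \<eta>.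
      ?N (insert i U) \<omega> / ?N (insert i W) \<omega> / ?N U \<omega>)"
    by (intro sum.cong) (auto simp: agreeing_def)
  also have "\<dots> = (\<Sum>\<eta>\<in>\<Omega>. \<Sum>\<omega> | \<omega> \<in> \<Omega> \<and> \<omega> \<in> agreeing \<Omega> s W \<eta>.
      ?N (insert i U) \<omega> / ?N (insert i W) \<omega> / ?N U \<omega>)"
    using fin by (intro sum.swap_restrict)
  also have "\<dots> = (\<Sum>\<eta>\<in>\<Omega>. (\<Sum>\<omega>\<in>agreeing \<Omega> s W \<eta>. ?N (insert i U) \<omega> / ?N (insert i W) \<omega>) / ?N U \<eta>)"
  proof (intro sum.cong refl)
    fix \<eta> assume "\<eta> \<in> \<Omega>"
    have "{\<omega>. \<omega> \<in> \<Omega> \<and> \<omega> \<in> agreeing \<Omega> s W \<eta>} = agreeing \<Omega> s W \<eta>" using sub by auto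
    then show "(\<Sum>\<omega> | \<omega> \<in> \<Omega> \<and> \<omega> \<in> agreeing \<Omega> s W \<eta>. ?N (insert i U) \<omega> / ?N (insert i W) \<omega> / ?N U \<omega>)
      = (\<Sum>\<omega>\<in>agreeing \<Omega> s W \<eta>. ?N (insert i U) \<omega> / ?N (insert i W) \<omega>) / ?N U \<eta>"
      by (simp add: sum_divide_distrib same cong: sum.cong)
  qed
  also have "\<dots> \<le> (\<Sum>\<eta>\<in>\<Omega>. 1)"
  proof (intro sum_mono)
    fix \<eta> assume \<eta>: "\<eta> \<in> \<Omega>"
    show "(\<Sum>\<omega>\<in>agreeing \<Omega> s W \<eta>. ?N (insert i U) \<omega> / ?N (insert i W) \<omega>) / ?N U \<eta> \<le> 1"
      using inner[OF \<eta>] pos[OF \<eta>] by (simp add: pos_divide_le_eq del: of_nat_0_less_iff)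
  qed
  finally show ?thesis by simp
qed

text \<open>Conditioning on more coordinates cannot raise the entropy of the bit at
  \<open>i\<close>: apply \<open>ln x \<le> x - 1\<close> to the ratio of ratios, whose mean is at
  most 1.\<close>

lemma trace_entropy_submodular:
  assumes fin: "finite \<Omega>" and UW: "U \<subseteq> W"
  shows "trace_entropy \<Omega> s (insert i W) - trace_entropy \<Omega> s W \<le>
         trace_entropy \<Omega> s (insert i U) - trace_entropy \<Omega> s U"
proof -
  define f where "f V \<omega> = real (card (agreeing \<Omega> s V \<omega>)) / real (card (agreeing \<Omega> s (insert i V) \<omega>))" for V \<omega>
  have pos: "f V \<omega> > 0" if "\<omega> \<in> \<Omega>" for V \<omega>
    using card_agreeing_pos[OF fin that, of s V] card_agreeing_pos[OF fin that, of s "insert i V"]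
    by (simp add: f_def)
  have "(\<Sum>\<omega>\<in>\<Omega>. ln (f W \<omega>) - ln (f U \<omega>)) \<le> (\<Sum>\<omega>\<in>\<Omega>. f W \<omega> / f U \<omega> - 1)"
  proof (intro sum_mono)
    fix \<omega> assume "\<omega> \<in> \<Omega>"
    then have p: "f W \<omega> > 0" "f U \<omega> > 0" using pos by auto
    then show "ln (f W \<omega>) - ln (f U \<omega>) \<le> f W \<omega> / f U \<omega> - 1"
      using ln_le_minus_one[of "f W \<omega> / f U \<omega>"] by (simp add: ln_div)
  qed
  also have "\<dots> \<le> 0"
    using sum_agreeing_ratio_le[OF fin UW, of s i] by (simp add: sum_subtractf f_def)
  finally have "(\<Sum>\<omega>\<in>\<Omega>. ln (f W \<omega>)) \<le> (\<Sum>\<omega>\<in>\<Omega>. ln (f U \<omega>))" by (simp add: sum_subtractf)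
  then have "(\<Sum>\<omega>\<in>\<Omega>. log 2 (f W \<omega>)) \<le> (\<Sum>\<omega>\<in>\<Omega>. log 2 (f U \<omega>))"
    by (simp add: log_def divide_right_mono flip: sum_divide_distrib)
  then show ?thesis
    unfolding trace_entropy_insert_diff[OF fin] f_def by (intro divide_right_mono) auto
qed

lemma trace_entropy_singleton:
  assumes fin: "finite \<Omega>" and ne: "\<Omega> \<noteq> {}"
  shows "trace_entropy \<Omega> s {i} = bin_entropy (card {\<omega> \<in> \<Omega>. i \<in> s \<omega>} / card \<Omega>)"
proof -
  define C D where "C = {\<omega> \<in> \<Omega>. i \<in> s \<omega>}" and "D = {\<omega> \<in> \<Omega>. i \<notin> s \<omega>}"
  have part: "\<Omega> = C \<union> D" "C \<inter> D = {}" "finite C" "finite D" using fin by (auto simp: C_def D_def)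
  have N: "real (card \<Omega>) = card C + card D"
    using part by (metis card_Un_disjoint of_nat_add)
  have N0: "card \<Omega> > 0" using fin ne by (simp add: card_gt_0_iff)
  have "agreeing \<Omega> s {i} \<omega> = C" if "\<omega> \<in> C" for \<omega> using that by (auto simp: agreeing_def C_def)
  moreover have "agreeing \<Omega> s {i} \<omega> = D" if "\<omega> \<in> D" for \<omega> using that by (auto simp: agreeing_def D_def)
  ultimately have "(\<Sum>\<omega>\<in>\<Omega>. log 2 (card \<Omega> / card (agreeing \<Omega> s {i} \<omega>))) =
     card C * log 2 (card \<Omega> / card C) + card D * log 2 (card \<Omega> / card D)"
    by (subst part(1), subst sum.union_disjoint) (use part in auto)
  also have "card C * log 2 (card \<Omega> / card C) = - (card C * log 2 (card C / card \<Omega>))"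
    using N0 by (cases "card C = 0") (auto simp: log_divide algebra_simps)
  also have "card D * log 2 (card \<Omega> / card D) = - (card D * log 2 (card D / card \<Omega>))"
    using N0 by (cases "card D = 0") (auto simp: log_divide algebra_simps)
  finally have *: "trace_entropy \<Omega> s {i} =
      - (card C / card \<Omega> * log 2 (card C / card \<Omega>) + card D / card \<Omega> * log 2 (card D / card \<Omega>))"
    by (simp add: trace_entropy_def diff_divide_distrib)
  have "card D / card \<Omega> = 1 - card C / card \<Omega>" using N N0 by (simp add: field_simps)
  then show ?thesis using * unfolding bin_entropy_def C_def[symmetric] by simp
qed

text \<open>The greedy vertex of the base polytope: \<open>v\<close> lists the increments of the entropy along an
  enumeration of \<open>W\<close>.\<close>

lemma trace_entropy_greedy:
  assumes fin: "finite \<Omega>" and "finite W"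
  shows "\<exists>v. (\<Sum>i\<in>W. v i) = trace_entropy \<Omega> s W \<and> (\<forall>U\<subseteq>W. (\<Sum>i\<in>U. v i) \<le> trace_entropy \<Omega> s U) \<and>
     (\<forall>i\<in>W. 0 \<le> v i \<and> v i \<le> trace_entropy \<Omega> s {i})"
  using \<open>finite W\<close>
proof induction
  case empty
  show ?case by auto
next
  case (insert j W)
  then obtain v where v: "(\<Sum>i\<in>W. v i) = trace_entropy \<Omega> s W"
    "\<And>U. U \<subseteq> W \<Longrightarrow> (\<Sum>i\<in>U. v i) \<le> trace_entropy \<Omega> s U"
    "\<And>i. i \<in> W \<Longrightarrow> 0 \<le> v i \<and> v i \<le> trace_entropy \<Omega> s {i}" by blast
  define v' where "v' = v(j := trace_entropy \<Omega> s (insert j W) - trace_entropy \<Omega> s W)"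
  have eq: "(\<Sum>i\<in>U. v' i) = (\<Sum>i\<in>U. v i)" if "U \<subseteq> W" for U
    using that insert(2) by (intro sum.cong) (auto simp: v'_def)
  have "(\<Sum>i\<in>insert j W. v' i) = trace_entropy \<Omega> s (insert j W)"
    using insert(1,2) eq[of W] v(1) by (simp add: v'_def)
  moreover have "(\<Sum>i\<in>U. v' i) \<le> trace_entropy \<Omega> s U" if U: "U \<subseteq> insert j W" for U
  proof (cases "j \<in> U")
    case False
    then have "U \<subseteq> W" using U by blast
    then show ?thesis using v(2)[of U] eq[of U] by simp
  next
    case True
    define U0 where "U0 = U - {j}"
    have U0: "U = insert j U0" "j \<notin> U0" "U0 \<subseteq> W" "finite U0"
      using True U insert(1) by (auto simp: U0_def intro: finite_subset)
    show ?thesis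
      using U0 v(2)[OF U0(3)] eq[OF U0(3)] trace_entropy_submodular[OF fin U0(3), of s j]
      by (simp add: v'_def)
  qed
  moreover have "0 \<le> v' i \<and> v' i \<le> trace_entropy \<Omega> s {i}" if "i \<in> insert j W" for i
    using that v(3) trace_entropy_mono[OF fin, of W "insert j W" s]
      trace_entropy_submodular[OF fin, of "{}" W s j] by (auto simp: v'_def)
  ultimately show ?case by blast
qed

lemma trace_entropy_subadditive:
  assumes fin: "finite \<Omega>" and "finite W"
  shows "trace_entropy \<Omega> s W \<le> (\<Sum>i\<in>W. trace_entropy \<Omega> s {i})"
proof -
  obtain v where "(\<Sum>i\<in>W. v i) = trace_entropy \<Omega> s W" "\<forall>i\<in>W. v i \<le> trace_entropy \<Omega> s {i}"
    using trace_entropy_greedy[OF assms, of s] by auto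
  then show ?thesis by (metis sum_mono)
qed

section \<open>The entropy bound for recovering pairs\<close>

definition freq :: "'a set set \<Rightarrow> 'a \<Rightarrow> real" where
  "freq \<F> i = card {F \<in> \<F>. i \<in> F} / card \<F>"

lemma freq_nonneg: "0 \<le> freq \<F> i"
  by (simp add: freq_def)

lemma freq_le_1: "finite \<F> \<Longrightarrow> freq \<F> i \<le> 1"
  by (auto simp: freq_def divide_le_eq card_gt_0_iff intro!: card_mono)

lemma sum_indicator_freq:
  assumes "finite \<F>" "\<F> \<noteq> {}"
  shows "(\<Sum>F\<in>\<F>. if i \<in> F then c else (0::real)) = card \<F> * (freq \<F> i * c)"
    and "(\<Sum>F\<in>\<F>. if i \<notin> F then c else (0::real)) = card \<F> * ((1 - freq \<F> i) * c)"
proof -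
  have "card \<F> \<noteq> 0" using assms by simp
  then show *: "(\<Sum>F\<in>\<F>. if i \<in> F then c else (0::real)) = card \<F> * (freq \<F> i * c)"
    using assms(1) by (simp add: freq_def flip: sum.inter_filter)
  have "(\<Sum>F\<in>\<F>. if i \<notin> F then c else 0) = (\<Sum>F\<in>\<F>. c - (if i \<in> F then c else 0))"
    by (intro sum.cong) auto
  also have "\<dots> = card \<F> * ((1 - freq \<F> i) * c)"
    unfolding sum_subtractf * by (simp add: algebra_simps)
  finally show "(\<Sum>F\<in>\<F>. if i \<notin> F then c else (0::real)) = card \<F> * ((1 - freq \<F> i) * c)" .
qed

lemma trace_entropy_inj:
  assumes "finite \<Omega>" "\<Omega> \<noteq> {}" "inj_on (\<lambda>\<omega>. s \<omega> \<inter> W) \<Omega>"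
  shows "trace_entropy \<Omega> s W = log 2 (card \<Omega>)"
proof -
  have "agreeing \<Omega> s W \<omega> = {\<omega>}" if "\<omega> \<in> \<Omega>" for \<omega>
    using assms(3) that by (auto simp: agreeing_def inj_on_def)
  then show ?thesis using assms(1,2) by (simp add: trace_entropy_def)
qed

section \<open>Entropy under the recovering condition\<close>

lemma recovering_pairD:
  assumes "recovering_pair X \<A> \<B>"
  shows "A \<in> \<A> \<Longrightarrow> A \<subseteq> X" "B \<in> \<B> \<Longrightarrow> B \<subseteq> X"
    and "\<lbrakk>A \<in> \<A>; A' \<in> \<A>; B \<in> \<B>; B' \<in> \<B>; A - B = A' - B'\<rbrakk> \<Longrightarrow> A = A'"
    and "\<lbrakk>A \<in> \<A>; A' \<in> \<A>; B \<in> \<B>; B' \<in> \<B>; B - A = B' - A'\<rbrakk> \<Longrightarrow> B = B'"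
proof -
  note def = assms[unfolded recovering_pair_def]
  note rec = def[THEN conjunct2, THEN conjunct2]
  show "A \<in> \<A> \<Longrightarrow> A \<subseteq> X" "B \<in> \<B> \<Longrightarrow> B \<subseteq> X"
    using def[THEN conjunct1] def[THEN conjunct2, THEN conjunct1] by auto
  show "A = A'" if "A \<in> \<A>" "A' \<in> \<A>" "B \<in> \<B>" "B' \<in> \<B>" "A - B = A' - B'"
    using rec[rule_format, OF that(1-4)] that(5) by simp
  show "B = B'" if "A \<in> \<A>" "A' \<in> \<A>" "B \<in> \<B>" "B' \<in> \<B>" "B - A = B' - A'"
    using rec[rule_format, OF that(1-4)] that(5) by simp
qed

lemma recovering_pair_sym:
  assumes "recovering_pair X \<A> \<B>"
  shows "recovering_pair X \<B> \<A>"
  unfolding recovering_pair_def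
proof (intro conjI ballI impI)
  show "\<B> \<subseteq> Pow X" "\<A> \<subseteq> Pow X" using recovering_pairD(1,2)[OF assms] by auto
  show "B = B'" if "B \<in> \<B>" "B' \<in> \<B>" "A \<in> \<A>" "A' \<in> \<A>" "B - A = B' - A'" for A A' B B'
    using recovering_pairD(4)[OF assms that(3,4,1,2,5)] .
  show "A = A'" if "B \<in> \<B>" "B' \<in> \<B>" "A \<in> \<A>" "A' \<in> \<A>" "A - B = A' - B'" for A A' B B'
    using recovering_pairD(3)[OF assms that(3,4,1,2,5)] .
qed

text \<open>Chain rule through \<open>A\<close>: the recovering condition makes \<open>A\<close> a
  function of \<open>A - B\<close>, and once \<open>A\<close> is known, \<open>A - B\<close> carries
  the same information as \<open>B \<inter> A\<close>.\<close>

lemma trace_entropy_diff: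
  assumes fin: "finite \<A>" "finite \<B>" and ne: "\<A> \<noteq> {}" "\<B> \<noteq> {}" and rec: "recovering_pair X \<A> \<B>"
  shows "trace_entropy (\<A> \<times> \<B>) (\<lambda>(A, B). A - B) X =
    log 2 (card \<A>) + (\<Sum>A\<in>\<A>. trace_entropy \<B> (\<lambda>B. B) A) / card \<A>"
proof -
  have pos: "card \<A> > 0" "card \<B> > 0" using fin ne by (auto simp: card_gt_0_iff)
  have inter_eq: "C \<inter> A = D \<inter> A" if "A - C = A - D" for A C D :: "'a set"
    using that by blast
  have fibre: "log 2 (card (\<A> \<times> \<B>) / card (agreeing (\<A> \<times> \<B>) (\<lambda>(A, B). A - B) X (A, B)))
      = log 2 (card \<A>) + log 2 (card \<B> / card (agreeing \<B> (\<lambda>B. B) A B))"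
    if AB: "A \<in> \<A>" "B \<in> \<B>" for A B
  proof -
    have *: "A' = A \<and> B' \<inter> A = B \<inter> A" if "A' \<in> \<A>" "B' \<in> \<B>" "(A' - B') \<inter> X = (A - B) \<inter> X" for A' B'
    proof -
      have "A' \<subseteq> X" "A \<subseteq> X" using that AB recovering_pairD(1)[OF rec] by auto
      then have eq: "A' - B' = A - B" using that(3) by blast
      then have A': "A' = A" by (rule recovering_pairD(3)[OF rec that(1) AB(1) that(2) AB(2)])
      have "B' \<inter> A = B \<inter> A" using eq unfolding A' by (rule inter_eq)
      then show ?thesis using A' by simp
    qed
    have "agreeing (\<A> \<times> \<B>) (\<lambda>(A, B). A - B) X (A, B) = {A} \<times> agreeing \<B> (\<lambda>B. B) A B"
    proof (intro equalityI subrelI subsetI)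
      fix \<omega> assume "\<omega> \<in> agreeing (\<A> \<times> \<B>) (\<lambda>(A, B). A - B) X (A, B)"
      then obtain A' B' where "\<omega> = (A', B')" "A' \<in> \<A>" "B' \<in> \<B>" "(A' - B') \<inter> X = (A - B) \<inter> X"
        by (auto simp: agreeing_def)
      then show "\<omega> \<in> {A} \<times> agreeing \<B> (\<lambda>B. B) A B"
        using *[of A' B'] by (simp add: agreeing_def)
    next
      fix \<omega> assume "\<omega> \<in> {A} \<times> agreeing \<B> (\<lambda>B. B) A B"
      then obtain B' where \<omega>: "\<omega> = (A, B')" "B' \<in> \<B>" "B' \<inter> A = B \<inter> A"
        by (auto simp: agreeing_def)
      then have "(A - B') \<inter> X = (A - B) \<inter> X" by blast
      then show "\<omega> \<in> agreeing (\<A> \<times> \<B>) (\<lambda>(A, B). A - B) X (A, B)"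
        using \<omega>(1,2) AB(1) unfolding agreeing_def by simp
    qed
    moreover have "card {A} = 1" by simp
    ultimately have "card (\<A> \<times> \<B>) / card (agreeing (\<A> \<times> \<B>) (\<lambda>(A, B). A - B) X (A, B)) =
        card \<A> * (card \<B> / card (agreeing \<B> (\<lambda>B. B) A B))"
      by (simp only: card_cartesian_product of_nat_mult times_divide_eq_right mult_1)
    moreover have "card (agreeing \<B> (\<lambda>B. B) A B) > 0"
      using AB fin by (intro card_agreeing_pos)
    ultimately show ?thesis
      using pos by (simp only: log_mult_pos of_nat_0_less_iff divide_pos_pos)
  qed
  have "(\<Sum>\<omega>\<in>\<A> \<times> \<B>. log 2 (card (\<A> \<times> \<B>) / card (agreeing (\<A> \<times> \<B>) (\<lambda>(A, B). A - B) X \<omega>)))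
    = (\<Sum>A\<in>\<A>. \<Sum>B\<in>\<B>. log 2 (card \<A>) + log 2 (card \<B> / card (agreeing \<B> (\<lambda>B. B) A B)))"
    unfolding sum.cartesian_product' by (rule sum.cong[OF refl], rule sum.cong[OF refl], rule fibre)
  also have "\<dots> = (\<Sum>A\<in>\<A>. card \<B> * (log 2 (card \<A>) + trace_entropy \<B> (\<lambda>B. B) A))"
    using pos by (intro sum.cong refl) (simp add: trace_entropy_def sum.distrib distrib_left)
  also have "\<dots> = card \<B> * (card \<A> * log 2 (card \<A>) + (\<Sum>A\<in>\<A>. trace_entropy \<B> (\<lambda>B. B) A))"
    by (simp add: sum.distrib flip: sum_distrib_left)
  finally have "trace_entropy (\<A> \<times> \<B>) (\<lambda>(A, B). A - B) X =
      card \<B> * (card \<A> * log 2 (card \<A>) + (\<Sum>A\<in>\<A>. trace_entropy \<B> (\<lambda>B. B) A)) / (card \<A> * card \<B>)"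
    unfolding trace_entropy_def[of "\<A> \<times> \<B>"] by (simp only: card_cartesian_product of_nat_mult)
  then show ?thesis using pos by (simp add: add_divide_distrib distrib_left)
qed

text \<open>\<open>V i\<close> is the average over \<open>A'\<close> of greedy weights for the
  entropy of \<open>B\<close> on \<open>X - A'\<close>. They sum to the full entropy because
  \<open>B - A'\<close> determines \<open>B\<close>, and count as 0 inside \<open>A'\<close>, which
  gives the factor \<open>1 - freq \<A> i\<close>. Restricted to \<open>A - A'\<close> they sum to
  at most the entropy of \<open>B \<inter> A\<close>; averaging over independent \<open>A\<close>
  and \<open>A'\<close> produces \<open>freq \<A> i * V i\<close>.\<close>

lemma recovering_pair_weights:
  assumes X: "finite X" and rec: "recovering_pair X \<A> \<B>" and ne: "\<A> \<noteq> {}" "\<B> \<noteq> {}"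
  shows "\<exists>V. (\<Sum>i\<in>X. V i) = log 2 (card \<B>) \<and>
    (\<forall>i\<in>X. 0 \<le> V i \<and> V i \<le> (1 - freq \<A> i) * bin_entropy (freq \<B> i)) \<and>
    log 2 (card \<A>) + (\<Sum>i\<in>X. freq \<A> i * V i) \<le> (\<Sum>i\<in>X. bin_entropy (freq \<A> i * (1 - freq \<B> i)))"
proof -
  have sub: "\<A> \<subseteq> Pow X" "\<B> \<subseteq> Pow X" using rec by (auto simp: recovering_pair_def)
  have fin: "finite \<A>" "finite \<B>" using sub X by (auto intro: finite_subset)
  have pos: "card \<A> > 0" "card \<B> > 0" using fin ne by (auto simp: card_gt_0_iff)
  define e where "e = trace_entropy \<B> (\<lambda>B. B)"
  have "\<forall>A'. \<exists>v. (\<Sum>i\<in>X - A'. v i) = e (X - A') \<and> (\<forall>U\<subseteq>X - A'. (\<Sum>i\<in>U. v i) \<le> e U) \<and>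
     (\<forall>i\<in>X - A'. 0 \<le> v i \<and> v i \<le> e {i})"
    unfolding e_def using trace_entropy_greedy[OF fin(2)] X by blast
  then obtain v where v: "\<And>A'. (\<Sum>i\<in>X - A'. v A' i) = e (X - A')"
     "\<And>A' U. U \<subseteq> X - A' \<Longrightarrow> (\<Sum>i\<in>U. v A' i) \<le> e U"
     "\<And>A' i. i \<in> X - A' \<Longrightarrow> 0 \<le> v A' i \<and> v A' i \<le> e {i}"
    by metis
  have e_single: "e {i} = bin_entropy (freq \<B> i)" for i
    unfolding e_def using trace_entropy_singleton[OF fin(2) ne(2)] by (simp add: freq_def)
  have e_full: "e (X - A') = log 2 (card \<B>)" if "A' \<in> \<A>" for A'
    unfolding e_def
  proof (rule trace_entropy_inj[OF fin(2) ne(2)], rule inj_onI)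
    fix B B' assume B: "B \<in> \<B>" "B' \<in> \<B>" and eq: "B \<inter> (X - A') = B' \<inter> (X - A')"
    have "B - A' = B' - A'" using eq B sub(2) by blast
    then show "B = B'" by (rule recovering_pairD(4)[OF rec that that B])
  qed
  define V where "V i = (\<Sum>A'\<in>\<A>. if i \<notin> A' then v A' i else 0) / card \<A>" for i
  have VW: "(\<Sum>A'\<in>\<A>. if i \<notin> A' then v A' i else 0) = card \<A> * V i" for i
    using pos by (simp add: V_def)
  have "(\<Sum>i\<in>X. V i) = (\<Sum>A'\<in>\<A>. \<Sum>i\<in>X. if i \<notin> A' then v A' i else 0) / card \<A>"
    unfolding V_def by (subst sum.swap) (simp add: sum_divide_distrib)
  also have "(\<Sum>A'\<in>\<A>. \<Sum>i\<in>X. if i \<notin> A' then v A' i else 0) = (\<Sum>A'\<in>\<A>. \<Sum>i\<in>X - A'. v A' i)"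
  proof (rule sum.cong[OF refl])
    fix A'
    have "X \<inter> {i. i \<notin> A'} = X - A'" by blast
    then show "(\<Sum>i\<in>X. if i \<notin> A' then v A' i else 0) = (\<Sum>i\<in>X - A'. v A' i)"
      using X by (simp add: sum.If_cases)
  qed
  also have "\<dots> = card \<A> * log 2 (card \<B>)" using v(1) e_full by simp
  finally have V1: "(\<Sum>i\<in>X. V i) = log 2 (card \<B>)" using pos by simp
  have V2: "0 \<le> V i \<and> V i \<le> (1 - freq \<A> i) * bin_entropy (freq \<B> i)" if "i \<in> X" for i
  proof
    show "0 \<le> V i" unfolding V_def using v(3) that by (intro divide_nonneg_nonneg sum_nonneg) auto
    have "(\<Sum>A'\<in>\<A>. if i \<notin> A' then v A' i else 0) \<le> (\<Sum>A'\<in>\<A>. if i \<notin> A' then bin_entropy (freq \<B> i) else 0)"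
      using v(3) that e_single by (intro sum_mono) auto
    also have "\<dots> = card \<A> * ((1 - freq \<A> i) * bin_entropy (freq \<B> i))"
      by (rule sum_indicator_freq(2)[OF fin(1) ne(1)])
    finally show "V i \<le> (1 - freq \<A> i) * bin_entropy (freq \<B> i)"
      using pos by (simp add: V_def divide_le_eq mult.commute)
  qed
  have lower: "(\<Sum>i\<in>X. freq \<A> i * V i) \<le> (\<Sum>A\<in>\<A>. e A) / card \<A>"
  proof -
    \<comment> \<open>The double sum over pairs factors, because membership of \<open>i\<close> in
      \<open>A\<close> and the weights of \<open>A'\<close> depend on independent choices.\<close>
    have "card \<A> * (\<Sum>i\<in>X. card \<A> * (freq \<A> i * V i)) =
        (\<Sum>i\<in>X. \<Sum>A\<in>\<A>. if i \<in> A then (\<Sum>A'\<in>\<A>. if i \<notin> A' then v A' i else 0) else 0)"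
      unfolding sum_indicator_freq(1)[OF fin(1) ne(1)] VW by (simp add: sum_distrib_left mult_ac)
    also have "\<dots> = (\<Sum>i\<in>X. \<Sum>A\<in>\<A>. \<Sum>A'\<in>\<A>. if i \<in> A - A' then v A' i else 0)"
      by (intro sum.cong refl) auto
    also have "\<dots> = (\<Sum>A\<in>\<A>. \<Sum>A'\<in>\<A>. \<Sum>i\<in>X. if i \<in> A - A' then v A' i else 0)"
      by (subst sum.swap, intro sum.cong refl, subst sum.swap, rule refl)
    also have "\<dots> = (\<Sum>A\<in>\<A>. \<Sum>A'\<in>\<A>. \<Sum>i\<in>A - A'. v A' i)"
    proof (rule sum.cong[OF refl], rule sum.cong[OF refl])
      fix A A' assume "A \<in> \<A>"
      then have "X \<inter> (A - A') = A - A'" using sub by blast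
      then show "(\<Sum>i\<in>X. if i \<in> A - A' then v A' i else 0) = (\<Sum>i\<in>A - A'. v A' i)"
        using X by (simp only: sum.inter_restrict[symmetric])
    qed
    also have "\<dots> \<le> (\<Sum>A\<in>\<A>. \<Sum>A'\<in>\<A>. e A)"
    proof (intro sum_mono)
      fix A A' assume "A \<in> \<A>"
      then have "(\<Sum>i\<in>A - A'. v A' i) \<le> e (A - A')" using sub by (intro v(2)) blast
      also have "\<dots> \<le> e A" unfolding e_def by (intro trace_entropy_mono fin) auto
      finally show "(\<Sum>i\<in>A - A'. v A' i) \<le> e A" .
    qed
    also have "\<dots> = card \<A> * (\<Sum>A\<in>\<A>. e A)" by (simp add: sum_distrib_left)
    finally have "(\<Sum>i\<in>X. card \<A> * (freq \<A> i * V i)) \<le> (\<Sum>A\<in>\<A>. e A)"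
      using pos by simp
    then show ?thesis using pos by (simp add: le_divide_eq mult.commute flip: sum_distrib_left)
  qed
  \<comment> \<open>By independence, \<open>i \<in> A - B\<close> has probability the product of
    \<open>freq \<A> i\<close> and \<open>1 - freq \<B> i\<close>.\<close>
  have single: "trace_entropy (\<A> \<times> \<B>) (\<lambda>(A, B). A - B) {i} = bin_entropy (freq \<A> i * (1 - freq \<B> i))" for i
  proof -
    have "{\<omega> \<in> \<A> \<times> \<B>. i \<in> (case \<omega> of (A, B) \<Rightarrow> A - B)} = {A \<in> \<A>. i \<in> A} \<times> (\<B> - {B \<in> \<B>. i \<in> B})"
      by auto
    moreover have "real (card (\<B> - {B \<in> \<B>. i \<in> B})) = card \<B> - real (card {B \<in> \<B>. i \<in> B})"
      using fin by (subst card_Diff_subset) (auto intro!: of_nat_diff card_mono)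
    ultimately have "card {\<omega> \<in> \<A> \<times> \<B>. i \<in> (case \<omega> of (A, B) \<Rightarrow> A - B)} / card (\<A> \<times> \<B>) =
        freq \<A> i * (1 - freq \<B> i)"
      using pos by (simp add: card_cartesian_product freq_def diff_divide_distrib right_diff_distrib)
    then show ?thesis using fin ne by (simp add: trace_entropy_singleton)
  qed
  have "log 2 (card \<A>) + (\<Sum>i\<in>X. freq \<A> i * V i) \<le> trace_entropy (\<A> \<times> \<B>) (\<lambda>(A, B). A - B) X"
    using lower trace_entropy_diff[OF fin ne rec] by (simp add: e_def)
  also have "\<dots> \<le> (\<Sum>i\<in>X. bin_entropy (freq \<A> i * (1 - freq \<B> i)))"
    using trace_entropy_subadditive[of "\<A> \<times> \<B>" X "\<lambda>(A, B). A - B"] fin X by (simp add: single)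
  finally show ?thesis using V1 V2 by blast
qed

text \<open>
  The weights \<open>3/5\<close> and \<open>9/20\<close> come from optimising a linear combination of the constraints on \<open>U\<close> and \<open>V\<close>;
  they make \<open>9/20 * (1 - x)\<^sup>2\<close> tangent to \<open>2/5 - 3/5 * x\<close> at \<open>x = 1/3\<close>, near the extremal density.
\<close>

lemma recovering_pair_entropy_bound:
  assumes X: "finite X" and rec: "recovering_pair X \<A> \<B>" and ne: "\<A> \<noteq> {}" "\<B> \<noteq> {}"
  shows "log 2 (card \<A>) + log 2 (card \<B>) \<le> (\<Sum>i\<in>X.
    3/5 * (bin_entropy (freq \<A> i * (1 - freq \<B> i)) + bin_entropy (freq \<B> i * (1 - freq \<A> i))) +
    9/20 * ((1 - freq \<B> i)^3 * bin_entropy (freq \<A> i) + (1 - freq \<A> i)^3 * bin_entropy (freq \<B> i)))"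
proof -
  let ?p = "freq \<A>" and ?q = "freq \<B>" and ?h = bin_entropy
  obtain V where V: "(\<Sum>i\<in>X. V i) = log 2 (card \<B>)"
    "\<And>i. i \<in> X \<Longrightarrow> 0 \<le> V i" "\<And>i. i \<in> X \<Longrightarrow> V i \<le> (1 - ?p i) * ?h (?q i)"
    "log 2 (card \<A>) + (\<Sum>i\<in>X. ?p i * V i) \<le> (\<Sum>i\<in>X. ?h (?p i * (1 - ?q i)))"
    using recovering_pair_weights[OF X rec ne] by blast
  obtain U where U: "(\<Sum>i\<in>X. U i) = log 2 (card \<A>)"
    "\<And>i. i \<in> X \<Longrightarrow> 0 \<le> U i" "\<And>i. i \<in> X \<Longrightarrow> U i \<le> (1 - ?q i) * ?h (?p i)"
    "log 2 (card \<B>) + (\<Sum>i\<in>X. ?q i * U i) \<le> (\<Sum>i\<in>X. ?h (?q i * (1 - ?p i)))"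
    using recovering_pair_weights[OF X recovering_pair_sym[OF rec] ne(2,1)] by blast
  \<comment> \<open>The coefficient \<open>2/5 - 3/5 * x\<close> turns negative beyond
    \<open>x = 2/3\<close>, so the upper bound on \<open>y\<close> cannot be inserted directly; the
    parabola above it is nonnegative.\<close>
  have *: "(2/5 - 3/5 * x) * y \<le> 9/20 * ((1 - x)^3 * z)" if "0 \<le> y" "y \<le> (1 - x) * z" for x y z :: real
  proof -
    have "0 \<le> 9/20 * (x - 1/3)\<^sup>2 * y" using that by simp
    then have "(2/5 - 3/5 * x) * y \<le> 9/20 * ((1 - x)\<^sup>2 * y)"
      by (simp add: power2_eq_square algebra_simps)
    also have "\<dots> \<le> 9/20 * ((1 - x)\<^sup>2 * ((1 - x) * z))"
      using that by (intro mult_left_mono) auto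
    finally show ?thesis by (simp add: power2_eq_square power3_eq_cube mult_ac)
  qed
  have expand: "(\<Sum>i\<in>X. (2/5 - 3/5 * x i) * y i) = 2/5 * (\<Sum>i\<in>X. y i) - 3/5 * (\<Sum>i\<in>X. x i * y i)"
    for x y :: "'a \<Rightarrow> real"
    by (simp add: left_diff_distrib sum_subtractf sum_distrib_left mult.assoc)
  \<comment> \<open>Each constraint enters with weight \<open>3/5\<close>; the remaining
    \<open>2/5\<close> of both logarithms is expressed through the sums of \<open>U\<close> and
    \<open>V\<close>.\<close>
  have "log 2 (card \<A>) + log 2 (card \<B>) = 3/5 * ((log 2 (card \<A>) + (\<Sum>i\<in>X. ?p i * V i)) +
        (log 2 (card \<B>) + (\<Sum>i\<in>X. ?q i * U i))) +
      ((\<Sum>i\<in>X. (2/5 - 3/5 * ?q i) * U i) + (\<Sum>i\<in>X. (2/5 - 3/5 * ?p i) * V i))"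
    unfolding expand U(1) V(1) by (simp add: algebra_simps)
  also have "\<dots> \<le> 3/5 * ((\<Sum>i\<in>X. ?h (?p i * (1 - ?q i))) + (\<Sum>i\<in>X. ?h (?q i * (1 - ?p i)))) +
      ((\<Sum>i\<in>X. 9/20 * ((1 - ?q i)^3 * ?h (?p i))) + (\<Sum>i\<in>X. 9/20 * ((1 - ?p i)^3 * ?h (?q i))))"
    using U V by (intro add_mono mult_left_mono sum_mono *) auto
  finally show ?thesis by (simp add: sum.distrib sum_distrib_left distrib_left)
qed

section \<open>An entropy inequality in two variables\<close>

lemma ln_ratio_convex: "convex_on {0..<1} (\<lambda>d::real. ln (1 + d) - ln (1 - d))"
proof (rule f''_ge0_imp_convex)
  show "((\<lambda>d. ln (1 + d) - ln (1 - d)) has_real_derivative 1 / (1 + x) + 1 / (1 - x)) (at x)"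
    if "x \<in> {0..<1}" for x :: real
    using that by (auto intro!: derivative_eq_intros simp: field_simps)
  show "((\<lambda>d. 1 / (1 + d) + 1 / (1 - d)) has_real_derivative 1 / (1 - x)\<^sup>2 - 1 / (1 + x)\<^sup>2) (at x)"
    if "x \<in> {0..<1}" for x :: real
    using that by (auto intro!: derivative_eq_intros simp: power2_eq_square)
  show "0 \<le> 1 / (1 - x)\<^sup>2 - 1 / (1 + x)\<^sup>2" if "x \<in> {0..<1}" for x :: real
    using that by (auto intro!: divide_left_mono power_mono)
qed auto

text \<open>The function is twice the inverse hyperbolic tangent. It vanishes at 0, so convexity
  keeps it below the chord from 0 to \<open>e\<close>; its quotient by \<open>d\<close> therefore
  increases.\<close>

lemma ln_ratio_le:
  assumes "0 \<le> d" "d \<le> e" "0 < e" "e < (1::real)"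
  shows "ln (1 + d) - ln (1 - d) \<le> d / e * (ln (1 + e) - ln (1 - e))"
  using convex_onD[OF ln_ratio_convex, of "d / e" 0 e] assms by simp

lemma bin_entropy_reflect: "bin_entropy (1 - x) = bin_entropy x"
  by (simp add: bin_entropy_def add.commute)

lemma bin_entropy_0 [simp]: "bin_entropy 0 = 0"
  by (simp add: bin_entropy_def)

lemma bin_entropy_1 [simp]: "bin_entropy 1 = 0"
  by (simp add: bin_entropy_def)

text \<open>The entropy of \<open>x\<close> is a concave function of \<open>(1 - 2 * x)\<^sup>2\<close>, so it lies below its
  tangents in this variable; equivalently in the variable \<open>x * (1 - x)\<close>.\<close>

lemma bin_entropy_le_tangent:
  assumes t: "0 < t" "t < 1/2" and x: "0 < x" "x < 1"
  shows "bin_entropy x \<le> bin_entropy t + log 2 ((1 - t) / t) / (1 - 2 * t) * (x * (1 - x) - t * (1 - t))"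
proof -
  define e where "e = 1 - 2 * t"
  define r where "r d = ln (1 + d) - ln (1 - d)" for d :: real
  \<comment> \<open>With \<open>d = 1 - 2 * x\<close>, this is \<open>ln 2\<close> times the
    difference between the tangent and the entropy, up to an additive constant. The claim says that
    \<open>f\<close> is least at \<open>e\<close>.\<close>
  define f where "f d = r e / e * ((1 - d\<^sup>2) / 4) +
    ((1 - d) / 2 * ln ((1 - d) / 2) + (1 + d) / 2 * ln ((1 + d) / 2))" for d
  have e: "0 < e" "e < 1" using t by (auto simp: e_def)
  have f: "f (1 - 2 * y) = r e / e * (y * (1 - y)) - ln 2 * bin_entropy y" for y
  proof -
    have "(1 - (1 - 2 * y)) / 2 = y" "(1 + (1 - 2 * y)) / 2 = 1 - y" "(1 - (1 - 2 * y)\<^sup>2) / 4 = y * (1 - y)"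
      by (simp_all add: power2_eq_square field_simps)
    then show ?thesis unfolding f_def bin_entropy_def log_def by (simp only:) (simp add: distrib_left right_diff_distrib)
  qed
  have deriv: "(f has_real_derivative (r d - d / e * r e) / 2) (at d)" if "0 \<le> d" "d < 1" for d
  proof -
    have xlnx: "((\<lambda>y. y * ln y) has_real_derivative ln y + 1) (at y)" if "0 < y" for y :: real
      using that by (auto intro!: derivative_eq_intros)
    have "((\<lambda>d. (1 - d) / 2 * ln ((1 - d) / 2)) has_real_derivative (ln ((1 - d) / 2) + 1) * (- 1 / 2)) (at d)"
      using that by (intro DERIV_chain2[OF xlnx]) (auto intro!: derivative_eq_intros)
    moreover have "((\<lambda>d. (1 + d) / 2 * ln ((1 + d) / 2)) has_real_derivative (ln ((1 + d) / 2) + 1) * (1 / 2)) (at d)"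
      using that by (intro DERIV_chain2[OF xlnx]) (auto intro!: derivative_eq_intros)
    moreover have "((\<lambda>d. r e / e * ((1 - d\<^sup>2) / 4)) has_real_derivative - (d / e * r e / 2)) (at d)"
      using e by (auto intro!: derivative_eq_intros)
    ultimately have "(f has_real_derivative - (d / e * r e / 2) +
        ((ln ((1 - d) / 2) + 1) * (- 1 / 2) + (ln ((1 + d) / 2) + 1) * (1 / 2))) (at d)"
      unfolding f_def by (intro DERIV_add)
    moreover have "ln ((1 - d) / 2) = ln (1 - d) - ln 2" "ln ((1 + d) / 2) = ln (1 + d) - ln 2"
      using that by (auto simp: ln_div)
    ultimately show ?thesis by (simp add: r_def diff_divide_distrib add_divide_distrib)
  qed
  \<comment> \<open>Since \<open>r d / d\<close> increases, \<open>f\<close> decreases up to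
    \<open>e\<close> and increases beyond it.\<close>
  have main: "f e \<le> f d" if d: "0 \<le> d" "d < 1" for d
  proof (cases "d \<le> e")
    case True
    show ?thesis
    proof (rule DERIV_nonpos_imp_nonincreasing[OF True])
      fix y assume y: "d \<le> y" "y \<le> e"
      have "r y - y / e * r e \<le> 0" using ln_ratio_le[of y e] y d e by (simp add: r_def)
      then show "\<exists>z. DERIV f y :> z \<and> z \<le> 0" using deriv[of y] y d e by force
    qed
  next
    case False
    show ?thesis
    proof (rule DERIV_nonneg_imp_nondecreasing[of e d f])
      show "e \<le> d" using False by simp
    next
      fix y assume y: "e \<le> y" "y \<le> d"
      have "r e \<le> e / y * r y" using ln_ratio_le[of e y] y d e by (simp add: r_def)
      then have "0 \<le> r y - y / e * r e" using y e by (simp add: field_simps)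
      then show "\<exists>z. DERIV f y :> z \<and> 0 \<le> z" using deriv[of y] y d e by force
    qed
  qed
  have "f (1 - 2 * t) \<le> f (1 - 2 * x)"
  proof (cases "x \<le> 1/2")
    case True
    then show ?thesis using main[of "1 - 2 * x"] x by (simp add: e_def)
  next
    case False
    then have "f e \<le> f (1 - 2 * (1 - x))" using x by (intro main) auto
    also have "\<dots> = f (1 - 2 * x)" by (subst (1 2) f) (simp add: bin_entropy_reflect mult.commute)
    finally show ?thesis by (simp add: e_def)
  qed
  then have "ln 2 * bin_entropy x \<le> ln 2 * bin_entropy t + r e / e * (x * (1 - x) - t * (1 - t))"
    unfolding f by (simp add: algebra_simps)
  moreover have "r e = ln 2 * log 2 ((1 - t) / t)"
  proof -
    have *: "1 + e = 2 * (1 - t)" "1 - e = 2 * t" by (auto simp: e_def)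
    show ?thesis unfolding r_def *
      using t ln_mult_pos[of 2 "1 - t"] ln_mult_pos[of 2 t] by (simp add: log_def ln_div)
  qed
  ultimately have "ln 2 * bin_entropy x \<le> ln 2 *
      (bin_entropy t + log 2 ((1 - t) / t) / e * (x * (1 - x) - t * (1 - t)))"
    by (simp add: distrib_left mult.assoc)
  then show ?thesis by (simp add: e_def)
qed

section \<open>Explicit tangents at 1/4, 1/3 and 1/9\<close>

lemma log2_3_bounds: "1.5849 \<le> log 2 (3::real)" "log 2 (3::real) \<le> 1.585"
proof -
  \<comment> \<open>\<open>84/53\<close> is a continued-fraction convergent of
    \<open>log 2 3\<close> from below.\<close>
  have "84 * ln (2::real) = ln (2 ^ 84)" by (simp only: ln_realpow of_nat_numeral)
  also have "\<dots> \<le> ln (3 ^ 53)" by (subst ln_le_cancel_iff) simp_all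
  also have "\<dots> = 53 * ln (3::real)" by (simp only: ln_realpow of_nat_numeral)
  finally have "84/53 \<le> log 2 (3::real)" by (simp add: log_def field_simps)
  then show "1.5849 \<le> log 2 (3::real)" by simp
  have "200 * ln (3::real) = ln (3 ^ 200)" by (simp only: ln_realpow of_nat_numeral)
  also have "\<dots> \<le> ln (2 ^ 317)" by (subst ln_le_cancel_iff) simp_all
  also have "\<dots> = 317 * ln (2::real)" by (simp only: ln_realpow of_nat_numeral)
  finally show "log 2 (3::real) \<le> 1.585" by (simp add: log_def field_simps)
qed

text \<open>At the tangent point 1/4 the odds \<open>(1 - t) / t\<close> are 3; the coefficients are
  rounded up. The point is close to \<open>2/9\<close>, the value of \<open>p * (1 - q)\<close> at
  \<open>p = q = 1/3\<close>.\<close>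

lemma bin_entropy_le_quarter:
  assumes "0 \<le> x" "x \<le> 1"
  shows "bin_entropy x \<le> 0.217 + 3.17 * (x * (1 - x))"
proof (cases "x = 0 \<or> x = 1")
  case False
  have "log 2 4 = (2::real)" using log2_of_power_eq[of 4 2] by simp
  then have eq: "bin_entropy (1/4) = 2 - 3/4 * log 2 3" "log 2 ((1 - 1/4) / (1/4)) = log 2 (3::real)"
    using log_divide[of 2 3 4] log_divide[of 2 1 4] by (simp_all add: bin_entropy_def field_simps)
  have "bin_entropy x \<le> (2 - 9/8 * log 2 3) + 2 * log 2 3 * (x * (1 - x))"
    using bin_entropy_le_tangent[of "1/4" x] False assms unfolding eq by (simp add: algebra_simps)
  also have "\<dots> \<le> 0.217 + 3.17 * (x * (1 - x))"
    using log2_3_bounds assms by (intro add_mono mult_right_mono) auto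
  finally show ?thesis .
qed auto

text \<open>At the tangent point 1/3 the odds are 2, so the slope is exactly 3 and only the constant
  is rounded.\<close>

lemma bin_entropy_le_third:
  assumes "0 \<le> x" "x \<le> 1"
  shows "bin_entropy x \<le> 0.2517 + 3 * (x * (1 - x))"
proof (cases "x = 0 \<or> x = 1")
  case False
  have eq: "bin_entropy (1/3) = log 2 3 - 2/3" "log 2 ((1 - 1/3) / (1/3)) = (1::real)"
    using log_divide[of 2 2 3] log_divide[of 2 1 3] by (simp_all add: bin_entropy_def field_simps)
  have "bin_entropy x \<le> (log 2 3 - 4/3) + 3 * (x * (1 - x))"
    using bin_entropy_le_tangent[of "1/3" x] False assms unfolding eq by (simp add: algebra_simps)
  also have "\<dots> \<le> 0.2517 + 3 * (x * (1 - x))"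
    using log2_3_bounds by simp
  finally show ?thesis .
qed auto

text \<open>At the tangent point 1/9 the odds are 8, so \<open>log 2 3\<close> enters only through
  the constant. This tangent serves \<open>p * (1 - q)\<close> when
  \<open>p \<le> 1/4\<close>.\<close>

lemma bin_entropy_le_ninth:
  assumes "0 \<le> x" "x \<le> 1"
  shows "bin_entropy x \<le> 0.1225 + 3.858 * (x * (1 - x))"
proof (cases "x = 0 \<or> x = 1")
  case False
  have "log 2 9 = 2 * log 2 (3::real)" using log_nat_power[of 3 2 2] by simp
  moreover have "log 2 8 = (3::real)" using log2_of_power_eq[of 8 3] by simp
  ultimately have eq: "bin_entropy (1/9) = 2 * log 2 3 - 8/3" "log 2 ((1 - 1/9) / (1/9)) = (3::real)"
    using log_divide[of 2 8 9] log_divide[of 2 1 9] by (simp_all add: bin_entropy_def field_simps)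
  have "bin_entropy x \<le> (2 * log 2 3 - 64/21) + 27/7 * (x * (1 - x))"
    using bin_entropy_le_tangent[of "1/9" x] False assms unfolding eq
    by (simp add: algebra_simps diff_divide_distrib)
  also have "\<dots> \<le> 0.1225 + 3.858 * (x * (1 - x))"
    using log2_3_bounds assms by (intro add_mono mult_right_mono) auto
  finally show ?thesis .
qed auto

text \<open>The blossom of the cubic with coefficients \<open>c 0\<close> to \<open>c 3\<close>:
  symmetric, affine in each argument, and equal to the cubic on the diagonal.\<close>

definition polar :: "(nat \<Rightarrow> real) \<Rightarrow> real \<Rightarrow> real \<Rightarrow> real \<Rightarrow> real" where
  "polar c x y z = c 0 + c 1 * (x + y + z) / 3 + c 2 * (x * y + y * z + z * x) / 3 + c 3 * (x * y * z)"

text \<open>The Bernstein coefficients of a cubic polynomial on \<open>[a, b]\<close> are the values of its polar form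
  at the end points.\<close>

lemma polar_nonneg:
  assumes "a < b" "a \<le> x" "x \<le> b"
    and "0 \<le> polar c a a a" "0 \<le> polar c a a b" "0 \<le> polar c a b b" "0 \<le> polar c b b b"
  shows "0 \<le> polar c x x x"
proof -
  have "(b - a)^3 * polar c x x x = (b - x)^3 * polar c a a a + 3 * ((b - x)\<^sup>2 * (x - a)) * polar c a a b +
      3 * ((b - x) * (x - a)\<^sup>2) * polar c a b b + (x - a)^3 * polar c b b b"
    unfolding polar_def power2_eq_square power3_eq_cube by (simp add: field_simps)
  also have "\<dots> \<ge> 0" using assms by (intro add_nonneg_nonneg mult_nonneg_nonneg) auto
  finally show ?thesis using assms(1) by (simp add: zero_le_mult_iff)
qed

lemma polar_commute:
  "polar (\<lambda>i. polar (c i) u v w) x y z = polar (\<lambda>j. polar (\<lambda>i. c i j) x y z) u v w"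
  unfolding polar_def by (simp add: algebra_simps add_divide_distrib)

text \<open>Up to order, all triples of end points; they yield the four Bernstein coefficients of a
  cubic.\<close>

definition box_corners :: "real \<Rightarrow> real \<Rightarrow> (real \<times> real \<times> real) set" where
  "box_corners a b = {(a, a, a), (a, a, b), (a, b, b), (b, b, b)}"

text \<open>Sixteen nonnegative Bernstein coefficients certify a bicubic on a rectangle.
  Nonnegativity in \<open>q\<close> is settled first for each triple in the \<open>p\<close>
  direction, after exchanging the two polarisations; nonnegativity in \<open>p\<close>
  follows.\<close>

lemma polar_polar_nonneg:
  assumes p: "a < b" "a \<le> p" "p \<le> b" and q: "a' < b'" "a' \<le> q" "q \<le> b'"
    and corners: "\<forall>(x, y, z)\<in>box_corners a b. \<forall>(u, v, w)\<in>box_corners a' b'.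
      0 \<le> polar (\<lambda>i. polar (c i) u v w) x y z"
  shows "0 \<le> polar (\<lambda>i. polar (c i) q q q) p p p"
proof (rule polar_nonneg[OF p])
  have "0 \<le> polar (\<lambda>i. polar (c i) q q q) x y z" if "(x, y, z) \<in> box_corners a b" for x y z
    unfolding polar_commute[of c]
    by (rule polar_nonneg[OF q]; unfold polar_commute[of c, symmetric])
      (use corners that in \<open>auto simp: box_corners_def\<close>)
  then show "0 \<le> polar (\<lambda>i. polar (c i) q q q) a a a" "0 \<le> polar (\<lambda>i. polar (c i) q q q) a a b"
    "0 \<le> polar (\<lambda>i. polar (c i) q q q) a b b" "0 \<le> polar (\<lambda>i. polar (c i) q q q) b b b"
    by (auto simp: box_corners_def)
qed

text \<open>In both bounds, \<open>c\<close> holds the coefficients of \<open>200000\<close> times the slack.\<close>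

lemma near_poly_bound:
  fixes p q :: real
  assumes "1/4 \<le> p" "p \<le> 1" "1/4 \<le> q" "q \<le> 1"
  defines "u \<equiv> p * (1 - q)" and "v \<equiv> q * (1 - p)"
  shows "3/5 * ((0.217 + 3.17 * (u * (1 - u))) + (0.217 + 3.17 * (v * (1 - v)))) +
    9/20 * ((1 - q)^3 * (0.2517 + 3 * (p * (1 - p))) + (1 - p)^3 * (0.2517 + 3 * (q * (1 - q)))) \<le> 1.1698"
    (is "?lhs \<le> _")
proof -
  define c :: "nat \<Rightarrow> nat \<Rightarrow> real" where "c i j = [[136574, -582441, 582441, 22653],
    [-582441, 2380800, -2380800, 270000], [582441, -2380800, 2380800, -270000],
    [22653, 270000, -270000, 0]] ! i ! j" for i j
  note simps = c_def box_corners_def polar_def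
  have eq: "1.1698 - ?lhs = polar (\<lambda>i. polar (c i) q q q) p p p / 200000"
    unfolding polar_def c_def u_def v_def power3_eq_cube by (simp add: eval_nat_numeral field_simps)
  \<comment> \<open>The square is cut into three rectangles, on each of which all sixteen Bernstein
    coefficients are nonnegative.\<close>
  consider "p \<le> 2/5" "q \<le> 2/5" | "p \<le> 2/5" "2/5 \<le> q" | "2/5 \<le> p" by linarith
  then have "0 \<le> polar (\<lambda>i. polar (c i) q q q) p p p"
  proof cases
    case 1
    show ?thesis
      by (rule polar_polar_nonneg[of "1/4" "2/5" _ "1/4" "2/5"]) (use 1 assms in \<open>simp_all add: simps\<close>)
  next
    case 2
    show ?thesis
      by (rule polar_polar_nonneg[of "1/4" "2/5" _ "2/5" 1]) (use 2 assms in \<open>simp_all add: simps\<close>)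
  next
    case 3
    show ?thesis
      by (rule polar_polar_nonneg[of "2/5" 1 _ "1/4" 1]) (use 3 assms in \<open>simp_all add: simps\<close>)
  qed
  then have "0 \<le> 1.1698 - ?lhs" unfolding eq by (rule divide_nonneg_pos) simp
  then show ?thesis by (rule diff_ge_0_iff_ge[THEN iffD1])
qed

lemma far_poly_bound:
  fixes p q :: real
  assumes "0 \<le> p" "p \<le> 1/4" "0 \<le> q" "q \<le> 1"
  defines "u \<equiv> p * (1 - q)" and "v \<equiv> q * (1 - p)"
  shows "3/5 * ((0.1225 + 3.858 * (u * (1 - u))) + (0.2517 + 3 * (v * (1 - v)))) +
    9/20 * ((1 - q)^3 * (0.2517 + 3 * (p * (1 - p))) + (1 - p)^3 * (0.2517 + 3 * (q * (1 - q)))) \<le> 1.1698"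
    (is "?lhs \<le> _")
proof -
  define c :: "nat \<Rightarrow> nat \<Rightarrow> real" where "c i j = [[143750, -562041, 562041, 22653],
    [-665001, 2442960, -2340000, 270000], [665001, -2545920, 2442960, -270000],
    [22653, 270000, -270000, 0]] ! i ! j" for i j
  note simps = c_def box_corners_def polar_def
  have eq: "1.1698 - ?lhs = polar (\<lambda>i. polar (c i) q q q) p p p / 200000"
    unfolding polar_def c_def u_def v_def power3_eq_cube by (simp add: eval_nat_numeral field_simps)
  \<comment> \<open>The rectangle is cut in \<open>q\<close> only, again until all coefficients are
    nonnegative on each piece.\<close>
  consider "q \<le> 3/10" | "3/10 \<le> q" "q \<le> 1/2" | "1/2 \<le> q" by linarith
  then have "0 \<le> polar (\<lambda>i. polar (c i) q q q) p p p"
  proof cases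
    case 1
    show ?thesis
      by (rule polar_polar_nonneg[of 0 "1/4" _ 0 "3/10"]) (use 1 assms in \<open>simp_all add: simps\<close>)
  next
    case 2
    show ?thesis
      by (rule polar_polar_nonneg[of 0 "1/4" _ "3/10" "1/2"]) (use 2 assms in \<open>simp_all add: simps\<close>)
  next
    case 3
    show ?thesis
      by (rule polar_polar_nonneg[of 0 "1/4" _ "1/2" 1]) (use 3 assms in \<open>simp_all add: simps\<close>)
  qed
  then have "0 \<le> 1.1698 - ?lhs" unfolding eq by (rule divide_nonneg_pos) simp
  then show ?thesis by (rule diff_ge_0_iff_ge[THEN iffD1])
qed

text \<open>Each product gets a tangent suited to its range: the one at 1/4 for both when
  \<open>p\<close> and \<open>q\<close> are at least \<open>1/4\<close>; otherwise the one at 1/9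
  for the product with the small factor and the one at 1/3 for the other. The left side is symmetric
  in \<open>p\<close> and \<open>q\<close>.\<close>

lemma entropy_inequality:
  assumes p: "0 \<le> p" "p \<le> 1" and q: "0 \<le> q" "q \<le> 1"
  shows "3/5 * (bin_entropy (p * (1 - q)) + bin_entropy (q * (1 - p))) +
    9/20 * ((1 - q)^3 * bin_entropy p + (1 - p)^3 * bin_entropy q) \<le> 1.1698"
proof -
  let ?tail = "\<lambda>p q. (1 - q)^3 * bin_entropy p + (1 - p)^3 * bin_entropy q"
  let ?tail_bound = "\<lambda>p q::real. (1 - q)^3 * (0.2517 + 3 * (p * (1 - p))) + (1 - p)^3 * (0.2517 + 3 * (q * (1 - q)))"
  have tail: "?tail p q \<le> ?tail_bound p q" if "0 \<le> p" "p \<le> 1" "0 \<le> q" "q \<le> 1" for p q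
    using that by (intro add_mono mult_left_mono bin_entropy_le_third) auto
  have unit: "0 \<le> p * (1 - q)" "p * (1 - q) \<le> 1" if "0 \<le> p" "p \<le> 1" "0 \<le> q" "q \<le> 1" for p q :: real
    using that by (auto intro: mult_le_one)
  have far: "3/5 * (bin_entropy (p * (1 - q)) + bin_entropy (q * (1 - p))) + 9/20 * ?tail p q \<le> 1.1698"
    if "0 \<le> p" "p \<le> 1/4" "0 \<le> q" "q \<le> 1" for p q
  proof (rule order_trans[OF _ far_poly_bound[OF that]], intro add_mono mult_left_mono)
    show "bin_entropy (p * (1 - q)) \<le> 0.1225 + 3.858 * (p * (1 - q) * (1 - p * (1 - q)))"
      using unit[of p q] that by (intro bin_entropy_le_ninth) auto
    show "bin_entropy (q * (1 - p)) \<le> 0.2517 + 3 * (q * (1 - p) * (1 - q * (1 - p)))"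
      using unit[of q p] that by (intro bin_entropy_le_third) auto
  qed (rule bin_entropy_le_third | use that in simp)+
  consider "p \<le> 1/4" | "q \<le> 1/4" | "1/4 \<le> p" "1/4 \<le> q" by linarith
  then show ?thesis
  proof cases
    case 1
    then show ?thesis using far[of p q] p q by simp
  next
    case 2
    then show ?thesis using far[of q p] p q by (simp add: add.commute)
  next
    case 3
    show ?thesis
    proof (rule order_trans[OF _ near_poly_bound[OF 3(1) p(2) 3(2) q(2)]], intro add_mono mult_left_mono)
      show "bin_entropy (p * (1 - q)) \<le> 0.217 + 3.17 * (p * (1 - q) * (1 - p * (1 - q)))"
        using unit[of p q] p q by (intro bin_entropy_le_quarter) auto
      show "bin_entropy (q * (1 - p)) \<le> 0.217 + 3.17 * (q * (1 - p) * (1 - q * (1 - p)))"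
        using unit[of q p] p q by (intro bin_entropy_le_quarter) auto
    qed (rule bin_entropy_le_third | use p q in simp)+
  qed
qed

section \<open>From bits to cardinalities\<close>

lemma two_powr_le: "2 powr 1.1698 \<le> (2.2499 :: real)"
proof -
  \<comment> \<open>\<open>62/53\<close> lies between \<open>1.1698\<close> and
    \<open>log 2 2.2499\<close>, which reduces the claim to a comparison of two powers.\<close>
  have "62 * ln (2::real) = ln (2 ^ 62)" by (simp only: ln_realpow of_nat_numeral)
  also have "\<dots> \<le> ln (2.2499 ^ 53)" by (subst ln_le_cancel_iff) (simp_all add: power_divide)
  also have "\<dots> = 53 * ln (2.2499::real)" by (simp only: ln_realpow of_nat_numeral)
  finally have "62/53 * ln (2::real) \<le> ln 2.2499" by simp
  have "ln (2 powr 1.1698) = 1.1698 * ln (2::real)" by (simp add: ln_powr)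
  also have "\<dots> \<le> 62/53 * ln 2" by (intro mult_right_mono) auto
  also have "\<dots> \<le> ln 2.2499" by fact
  finally show ?thesis by (subst (asm) ln_le_cancel_iff) auto
qed

lemma recovering_pair_card_le:
  assumes X: "finite X" and rec: "recovering_pair X \<A> \<B>"
  shows "real (card \<A>) * real (card \<B>) \<le> 2.2499 ^ card X"
proof (cases "\<A> = {} \<or> \<B> = {}")
  case False
  have fin: "finite \<A>" "finite \<B>"
    using X recovering_pairD(1,2)[OF rec] by (auto intro!: finite_subset[of _ "Pow X"])
  have pos: "0 < card \<A>" "0 < card \<B>" using False fin by (auto simp: card_gt_0_iff)
  have "log 2 (card \<A>) + log 2 (card \<B>) \<le> (\<Sum>i\<in>X. 1.1698)"
    using False
    by (intro order_trans[OF recovering_pair_entropy_bound[OF X rec]] sum_mono entropy_inequality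
        freq_nonneg freq_le_1 fin) auto
  then have "log 2 (card \<A> * card \<B>) \<le> 1.1698 * card X"
    using pos by (simp add: log_mult_pos)
  then have "real (card \<A> * card \<B>) \<le> 2 powr (1.1698 * card X)"
    using pos by (subst (asm) log_le_iff) auto
  also have "\<dots> = (2 powr 1.1698) ^ card X"
    unfolding powr_powr[symmetric] by (rule powr_realpow) simp
  also have "\<dots> \<le> 2.2499 ^ card X"
    by (intro power_mono two_powr_le) auto
  finally show ?thesis by simp
qed auto

section \<open>A large cancellative family\<close>

text \<open>Toggling a fixed element of \<open>D\<close> in \<open>h\<close> changes the parity,
  which pairs the even \<open>h\<close> with the odd ones.\<close>

lemma card_even_inter:
  assumes X: "finite X" and D: "D \<subseteq> X" "D \<noteq> {}"
  shows "2 * card {h \<in> Pow X. even (card (D \<inter> h))} = 2 ^ card X"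
proof -
  obtain d where d: "d \<in> D" using D(2) by blast
  define flip where "flip h = (if d \<in> h then h - {d} else insert d h)" for h
  have parity: "even (card (D \<inter> flip h)) \<longleftrightarrow> odd (card (D \<inter> h))" if "h \<in> Pow X" for h
  proof -
    have fin: "finite (D \<inter> h)" using that X by (auto intro: finite_subset[of _ X])
    show ?thesis
    proof (cases "d \<in> h")
      case True
      then have "D \<inter> h = insert d (D \<inter> flip h)" "d \<notin> D \<inter> flip h" using d by (auto simp: flip_def)
      then show ?thesis using fin by (metis card_insert_disjoint even_Suc finite_insert)
    next
      case False
      then have "D \<inter> flip h = insert d (D \<inter> h)" "d \<notin> D \<inter> h" using d by (auto simp: flip_def)
      then show ?thesis using fin by simp
    qed
  qed
  have "bij_betw flip {h \<in> Pow X. even (card (D \<inter> h))} {h \<in> Pow X. odd (card (D \<inter> h))}"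
  proof (rule bij_betw_byWitness[where f' = flip])
    have "flip h \<in> Pow X" if "h \<in> Pow X" for h using that d D(1) by (auto simp: flip_def)
    then show "flip ` {h \<in> Pow X. even (card (D \<inter> h))} \<subseteq> {h \<in> Pow X. odd (card (D \<inter> h))}"
      "flip ` {h \<in> Pow X. odd (card (D \<inter> h))} \<subseteq> {h \<in> Pow X. even (card (D \<inter> h))}"
      using parity by blast+
  qed (auto simp: flip_def)
  then have "card {h \<in> Pow X. odd (card (D \<inter> h))} = card {h \<in> Pow X. even (card (D \<inter> h))}"
    by (simp add: bij_betw_same_card)
  moreover have "card (Pow X) = card {h \<in> Pow X. even (card (D \<inter> h))} + card {h \<in> Pow X. odd (card (D \<inter> h))}"
    using X by (subst card_Un_disjoint[symmetric]) (auto intro!: arg_cong[where f = card])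
  ultimately show ?thesis using X by (simp add: card_Pow)
qed

text \<open>\<open>K\<close> will hold the supports of nonzero words of a binary code. Each counted
  pair is an obstruction to keeping \<open>B\<close> in a cancellative family.\<close>

definition contained_pairs :: "'a set set \<Rightarrow> 'a set set \<Rightarrow> nat" where
  "contained_pairs \<G> K = (\<Sum>B\<in>\<G>. card {D \<in> K. D \<subseteq> B})"

text \<open>Double counting: each nonempty \<open>D\<close> passes exactly half of all parity checks
  \<open>h\<close>.\<close>

lemma sum_contained_pairs_even:
  assumes X: "finite X" and K: "K \<subseteq> Pow X - {{}}"
  shows "2 * (\<Sum>h\<in>Pow X. contained_pairs \<G> {D \<in> K. even (card (D \<inter> h))}) = 2 ^ card X * contained_pairs \<G> K"
proof -
  have fin: "finite K" using finite_subset[OF K] X by simp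
  have count: "card {x \<in> S. Q x} = (\<Sum>x\<in>S. if Q x then 1 else 0)" if "finite S" for S :: "'a set set" and Q
    using sum.inter_filter[OF that, of "\<lambda>_. 1::nat" Q] by simp
  have "(\<Sum>h\<in>Pow X. contained_pairs \<G> {D \<in> K. even (card (D \<inter> h))}) =
      (\<Sum>h\<in>Pow X. \<Sum>B\<in>\<G>. \<Sum>D | D \<in> K \<and> D \<subseteq> B. if even (card (D \<inter> h)) then 1 else 0)"
    unfolding contained_pairs_def
  proof (rule sum.cong[OF refl], rule sum.cong[OF refl])
    fix h B
    have eq: "{D \<in> {D \<in> K. even (card (D \<inter> h))}. D \<subseteq> B} = {D \<in> {D \<in> K. D \<subseteq> B}. even (card (D \<inter> h))}"
      by blast
    show "card {D \<in> {D \<in> K. even (card (D \<inter> h))}. D \<subseteq> B} =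
        (\<Sum>D | D \<in> K \<and> D \<subseteq> B. if even (card (D \<inter> h)) then 1 else 0)"
      unfolding eq using fin by (intro count) simp
  qed
  also have "\<dots> = (\<Sum>B\<in>\<G>. \<Sum>D | D \<in> K \<and> D \<subseteq> B. \<Sum>h\<in>Pow X. if even (card (D \<inter> h)) then 1 else 0)"
    by (subst sum.swap, rule sum.cong[OF refl], subst sum.swap, rule refl)
  also have "\<dots> = (\<Sum>B\<in>\<G>. \<Sum>D | D \<in> K \<and> D \<subseteq> B. card {h \<in> Pow X. even (card (D \<inter> h))})"
    using X by (simp only: count finite_Pow_iff)
  finally have "2 * (\<Sum>h\<in>Pow X. contained_pairs \<G> {D \<in> K. even (card (D \<inter> h))}) =
      (\<Sum>B\<in>\<G>. \<Sum>D | D \<in> K \<and> D \<subseteq> B. 2 * card {h \<in> Pow X. even (card (D \<inter> h))})"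
    by (simp add: sum_distrib_left)
  also have "\<dots> = (\<Sum>B\<in>\<G>. \<Sum>D | D \<in> K \<and> D \<subseteq> B. 2 ^ card X)"
    using K by (intro sum.cong refl card_even_inter[OF X]) auto
  finally show ?thesis by (simp add: contained_pairs_def sum_distrib_left mult.commute)
qed

text \<open>Average over all parity checks \<open>h\<close>, then keep the better of the two parity classes.\<close>

lemma parity_split:
  fixes \<kappa> :: real
  assumes X: "finite X" and \<G>: "finite \<G>" and K: "K \<subseteq> Pow X - {{}}"
  shows "\<exists>h t. (card \<G> - \<kappa> * contained_pairs \<G> K) / 2 \<le>
    card {B \<in> \<G>. even (card (B \<inter> h)) = t} -
    2 * \<kappa> * contained_pairs {B \<in> \<G>. even (card (B \<inter> h)) = t} {D \<in> K. even (card (D \<inter> h))}"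
proof -
  define K' where "K' h = {D \<in> K. even (card (D \<inter> h))}" for h
  \<comment> \<open>Passing to \<open>K' h\<close> halves the pairs on average over
    \<open>h\<close>, so with the doubled weight the right-hand side averages to the left-hand
    side.\<close>
  have "\<exists>h\<in>Pow X. card \<G> - \<kappa> * contained_pairs \<G> K \<le> card \<G> - 2 * \<kappa> * contained_pairs \<G> (K' h)"
  proof (rule ccontr)
    assume "\<not> ?thesis"
    then have "(\<Sum>h\<in>Pow X. card \<G> - 2 * \<kappa> * contained_pairs \<G> (K' h)) <
        (\<Sum>h\<in>Pow X. card \<G> - \<kappa> * contained_pairs \<G> K)"
      using X by (intro sum_strict_mono) (auto simp: not_le)
    moreover have "2 * (\<Sum>h\<in>Pow X. real (contained_pairs \<G> (K' h))) = 2 ^ card X * real (contained_pairs \<G> K)"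
      using arg_cong[OF sum_contained_pairs_even[OF X K, of \<G>], of real] by (simp add: K'_def)
    then have "(\<Sum>h\<in>Pow X. 2 * \<kappa> * contained_pairs \<G> (K' h)) = \<kappa> * (2 ^ card X * real (contained_pairs \<G> K))"
      by (simp only: sum_distrib_left[symmetric] mult.commute[of 2 \<kappa>] mult.assoc)
    ultimately show False using X by (simp add: sum_subtractf card_Pow right_diff_distrib)
  qed
  then obtain h where h: "card \<G> - \<kappa> * contained_pairs \<G> K \<le> card \<G> - 2 * \<kappa> * contained_pairs \<G> (K' h)" by blast
  define E where "E t = {B \<in> \<G>. even (card (B \<inter> h)) = t}" for t
  have E: "\<G> = E True \<union> E False" "finite (E True)" "finite (E False)" "E True \<inter> E False = {}"
    using \<G> by (auto simp: E_def)
  have "card \<G> = card (E True) + card (E False)"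
    by (subst E(1)) (rule card_Un_disjoint[OF E(2-)])
  moreover have "contained_pairs \<G> (K' h) = contained_pairs (E True) (K' h) + contained_pairs (E False) (K' h)"
    unfolding contained_pairs_def by (subst E(1)) (rule sum.union_disjoint[OF E(2-)])
  ultimately have "card \<G> - \<kappa> * contained_pairs \<G> K \<le>
      (card (E True) - 2 * \<kappa> * contained_pairs (E True) (K' h)) +
      (card (E False) - 2 * \<kappa> * contained_pairs (E False) (K' h))"
    using h by (simp add: distrib_left)
  moreover have "a / 2 \<le> x \<or> a / 2 \<le> y" if "a \<le> x + y" for a x y :: real
    using that by linarith
  ultimately have "\<exists>t. (card \<G> - \<kappa> * contained_pairs \<G> K) / 2 \<le> card (E t) - 2 * \<kappa> * contained_pairs (E t) (K' h)"
    unfolding ex_bool_eq by blast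
  then show ?thesis unfolding E_def K'_def by blast
qed

text \<open>Over the field with two elements, pairing with \<open>h\<close> is linear, and the
  symmetric difference is the sum.\<close>

lemma even_card_sym_diff:
  assumes "finite A" "finite B" "even (card (A \<inter> h)) = even (card (B \<inter> h))"
  shows "even (card (((A - B) \<union> (B - A)) \<inter> h))"
proof -
  have *: "card (C \<inter> h) = card ((C - D) \<inter> h) + card (C \<inter> D \<inter> h)" if "finite C" for C D :: "'a set"
    using that by (subst card_Un_disjoint[symmetric]) (auto intro!: arg_cong[where f = card])
  have "card (((A - B) \<union> (B - A)) \<inter> h) = card ((A - B) \<inter> h) + card ((B - A) \<inter> h)"
    using assms by (subst card_Un_disjoint[symmetric]) (auto intro!: arg_cong[where f = card])
  then show ?thesis using assms(3) *[OF assms(1), of B] *[OF assms(2), of A] by (auto simp: Int_ac)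
qed

text \<open>The construction keeps \<open>\<G>\<close> inside one coset of a linear code, with
  \<open>K\<close> as the set of its nonzero words. The weight of a pair doubles every round, and
  the potential on the right is at least half its previous value.\<close>

lemma iterated_parity_split:
  fixes \<kappa> :: real
  assumes X: "finite X" and F: "F \<subseteq> Pow X"
  shows "\<exists>\<G>\<subseteq>F. \<exists>K\<subseteq>Pow X - {{}}.
    (\<forall>A\<in>\<G>. \<forall>A'\<in>\<G>. A \<noteq> A' \<longrightarrow> (A - A') \<union> (A' - A) \<in> K) \<and>
    (card F - \<kappa> * contained_pairs F (Pow X - {{}})) / 2 ^ m \<le> card \<G> - \<kappa> * 2 ^ m * contained_pairs \<G> K"
proof (induction m)
  case 0
  show ?case
  proof (rule exI[of _ F], rule conjI[OF subset_refl], rule exI[of _ "Pow X - {{}}"],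
      rule conjI[OF subset_refl], intro conjI ballI impI)
    fix A A' assume "A \<in> F" "A' \<in> F" "A \<noteq> A'"
    then have "A \<subseteq> X" "A' \<subseteq> X" "(A - A') \<union> (A' - A) \<noteq> {}" using F by auto
    then show "(A - A') \<union> (A' - A) \<in> Pow X - {{}}" by blast
  qed simp
next
  case (Suc m)
  then obtain \<G> K where G: "\<G> \<subseteq> F" "K \<subseteq> Pow X - {{}}"
    "\<forall>A\<in>\<G>. \<forall>A'\<in>\<G>. A \<noteq> A' \<longrightarrow> (A - A') \<union> (A' - A) \<in> K"
    and pot: "(card F - \<kappa> * contained_pairs F (Pow X - {{}})) / 2 ^ m \<le> card \<G> - \<kappa> * 2 ^ m * contained_pairs \<G> K"
    by (elim exE conjE) (rule that)
  have sub: "\<G> \<subseteq> Pow X" using G(1) F by (rule subset_trans)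
  then have fin: "finite \<G>" by (rule finite_subset) (simp add: X)
  obtain h t where ht: "(card \<G> - \<kappa> * 2 ^ m * contained_pairs \<G> K) / 2 \<le>
    card {B \<in> \<G>. even (card (B \<inter> h)) = t} -
    2 * (\<kappa> * 2 ^ m) * contained_pairs {B \<in> \<G>. even (card (B \<inter> h)) = t} {D \<in> K. even (card (D \<inter> h))}"
    using parity_split[OF X fin G(2), of "\<kappa> * 2 ^ m"] by (elim exE) (rule that)
  have finA: "finite A" if "A \<in> \<G>" for A using that sub finite_subset[OF _ X] by blast
  let ?\<G> = "{B \<in> \<G>. even (card (B \<inter> h)) = t}" and ?K = "{D \<in> K. even (card (D \<inter> h))}"
  show ?case
  proof (rule exI[of _ ?\<G>], rule conjI, use G(1) in blast, rule exI[of _ ?K], rule conjI, use G(2) in blast,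
      intro conjI ballI impI)
    fix A A' assume A: "A \<in> ?\<G>" "A' \<in> ?\<G>" "A \<noteq> A'"
    then have "even (card ((A - A' \<union> (A' - A)) \<inter> h))"
      using finA by (intro even_card_sym_diff) simp_all
    moreover have "A - A' \<union> (A' - A) \<in> K" using A G(3) by simp
    ultimately show "A - A' \<union> (A' - A) \<in> ?K" by simp
  next
    have "(card F - \<kappa> * contained_pairs F (Pow X - {{}})) / 2 ^ Suc m \<le>
        (card \<G> - \<kappa> * 2 ^ m * contained_pairs \<G> K) / 2"
      using divide_right_mono[OF pot, of 2] by (simp only: power_Suc2 divide_divide_eq_left zero_le_numeral)
    also note ht
    also have "2 * (\<kappa> * 2 ^ m) = \<kappa> * 2 ^ Suc m" by simp
    finally show "(card F - \<kappa> * contained_pairs F (Pow X - {{}})) / 2 ^ Suc m \<le>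
        card ?\<G> - \<kappa> * 2 ^ Suc m * contained_pairs ?\<G> ?K" .
  qed
qed

text \<open>Deletion: remove from \<open>\<G>\<close> every set that contains a member of
  \<open>K\<close>. If \<open>A - B = A' - B\<close> with \<open>A \<noteq> A'\<close>, the
  symmetric difference of \<open>A\<close> and \<open>A'\<close> is a member of \<open>K\<close>
  inside \<open>B\<close>, so the survivors are cancellative.\<close>

lemma cancellative_family:
  assumes X: "finite X" and F: "F \<subseteq> Pow X"
  shows "\<exists>\<G>. cancellative_pair X \<G> \<G> \<and>
    (real (card F) - real (contained_pairs F (Pow X - {{}})) / 2 ^ m) / 2 ^ m \<le> real (card \<G>)"
proof -
  \<comment> \<open>The weight \<open>1 / 2 ^ m\<close> is chosen so that a pair costs exactly 1
    after \<open>m\<close> rounds, enough to pay for one deleted set.\<close>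
  obtain \<G> K where G: "\<G> \<subseteq> F" "K \<subseteq> Pow X - {{}}"
    "\<forall>A\<in>\<G>. \<forall>A'\<in>\<G>. A \<noteq> A' \<longrightarrow> (A - A') \<union> (A' - A) \<in> K"
    and pot: "(real (card F) - 1 / 2 ^ m * real (contained_pairs F (Pow X - {{}}))) / 2 ^ m \<le>
      real (card \<G>) - 1 / 2 ^ m * 2 ^ m * real (contained_pairs \<G> K)"
    using iterated_parity_split[OF X F, of "1 / 2 ^ m" m] by (elim exE conjE) (rule that)
  have "\<G> \<subseteq> Pow X" "K \<subseteq> Pow X" using G(1,2) F by auto
  then have fin: "finite \<G>" "finite K" using finite_subset[of _ "Pow X"] X by auto
  define H where "H = {B \<in> \<G>. \<forall>D\<in>K. \<not> D \<subseteq> B}"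
  have "cancellative_pair X H H"
  proof -
    have "A = A'" if "A \<in> H" "A' \<in> H" "B \<in> H" "A - B = A' - B" for A A' B
    proof (rule ccontr)
      assume "A \<noteq> A'"
      then have "(A - A') \<union> (A' - A) \<in> K" using that(1,2) G(3) by (simp add: H_def)
      moreover have "(A - A') \<union> (A' - A) \<subseteq> B" using that(4) by blast
      ultimately show False using that(3) by (auto simp: H_def)
    qed
    moreover have "H \<subseteq> Pow X" using G(1) F by (auto simp: H_def)
    ultimately show ?thesis unfolding cancellative_pair_def by simp
  qed
  moreover have "card (\<G> - H) \<le> contained_pairs \<G> K"
  proof -
    have "card (\<G> - H) = (\<Sum>B\<in>\<G> - H. 1)" by simp
    also have "\<dots> \<le> (\<Sum>B\<in>\<G> - H. card {D \<in> K. D \<subseteq> B})"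
      using fin by (intro sum_mono) (auto simp: H_def Suc_le_eq card_gt_0_iff)
    also have "\<dots> \<le> contained_pairs \<G> K"
      unfolding contained_pairs_def using fin by (intro sum_mono2) auto
    finally show ?thesis .
  qed
  moreover have "card \<G> = card H + card (\<G> - H)"
    using fin by (subst card_Un_disjoint[symmetric]) (auto simp: H_def intro!: arg_cong[where f = card])
  ultimately show ?thesis using pot by (intro exI[of _ H]) simp
qed

text \<open>A set of size \<open>w\<close> has at most \<open>2 ^ w\<close> nonempty subsets, so
  with \<open>w + 1\<close> checks the obstructions cost at most half of the family; this half
  raises the exponent to \<open>w + 2\<close>.\<close>

lemma cancellative_family_binomial:
  "\<exists>\<G>. cancellative_pair {1..n::nat} \<G> \<G> \<and> (n choose w) / 2 ^ (w + 2) \<le> real (card \<G>)"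
proof -
  define F where "F = {B. B \<subseteq> {1..n} \<and> card B = w}"
  have cF: "card F = n choose w" unfolding F_def by (subst n_subsets) auto
  have "contained_pairs F (Pow {1..n} - {{}}) \<le> (\<Sum>B\<in>F. 2 ^ w)"
    unfolding contained_pairs_def
  proof (intro sum_mono)
    fix B assume B: "B \<in> F"
    then have "finite B" using finite_subset[of B "{1..n}"] by (simp add: F_def)
    then have "card {D \<in> Pow {1..n} - {{}}. D \<subseteq> B} \<le> card (Pow B)" by (intro card_mono) auto
    then show "card {D \<in> Pow {1..n} - {{}}. D \<subseteq> B} \<le> 2 ^ w"
      using B \<open>finite B\<close> by (simp add: card_Pow F_def)
  qed
  then have "real (contained_pairs F (Pow {1..n} - {{}})) \<le> real ((n choose w) * 2 ^ w)"
    unfolding of_nat_le_iff by (simp add: cF)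
  then have "(n choose w) / 2 ^ (w + 2) \<le> (real (card F) - real (contained_pairs F (Pow {1..n} - {{}})) / 2 ^ (w + 1)) / 2 ^ (w + 1)"
    by (simp add: cF field_simps)
  moreover have "\<exists>\<G>. cancellative_pair {1..n} \<G> \<G> \<and>
      (real (card F) - real (contained_pairs F (Pow {1..n} - {{}})) / 2 ^ (w + 1)) / 2 ^ (w + 1) \<le> real (card \<G>)"
    by (rule cancellative_family) (auto simp: F_def)
  ultimately show ?thesis using order_trans by blast
qed

text \<open>\<open>(1 + 1/2) ^ n\<close> expands into the \<open>n + 1\<close> terms
  \<open>(n choose w) / 2 ^ w\<close>, so some \<open>w\<close> reaches the average.\<close>

lemma cancellative_family_three_halves:
  "\<exists>\<G>. cancellative_pair {1..n::nat} \<G> \<G> \<and> (3/2) ^ n / (4 * (real n + 1)) \<le> real (card \<G>)"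
proof -
  have "(3/2 :: real) ^ n = (\<Sum>w\<le>n. (n choose w) / 2 ^ w)"
    using binomial_ring[of "1/2::real" 1 n] by (simp add: power_divide)
  have "\<exists>w\<le>n. (3/2) ^ n / (real n + 1) \<le> (n choose w) / 2 ^ w"
  proof (rule ccontr)
    assume "\<not> ?thesis"
    then have "(n choose w) / 2 ^ w < (3/2) ^ n / (real n + 1)" if "w \<le> n" for w
      using that by (meson not_le)
    then have "(\<Sum>w\<le>n. (n choose w) / 2 ^ w) < (\<Sum>w\<le>n. (3/2) ^ n / (real n + 1))"
      by (intro sum_strict_mono) auto
    also have "(\<Sum>w\<le>n. c / (real n + 1)) = c" for c :: real by (simp add: field_simps)
    finally show False using \<open>(3/2) ^ n = _\<close> by simp
  qed
  then obtain w where w: "(3/2) ^ n / (real n + 1) \<le> (n choose w) / 2 ^ w" by blast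
  have "(3/2) ^ n / (4 * (real n + 1)) = (3/2) ^ n / (real n + 1) / 4" by simp
  also have "\<dots> \<le> (n choose w) / 2 ^ w / 4" using w by (intro divide_right_mono) auto
  also have "\<dots> = (n choose w) / 2 ^ (w + 2)" by (simp add: power_add)
  finally show ?thesis using cancellative_family_binomial[of n w] order_trans by blast
qed

section \<open>Rates\<close>

lemma superadditive_mult:
  fixes u :: "nat \<Rightarrow> real"
  assumes super: "\<And>m n. u m + u n \<le> u (m + n)" and nonneg: "\<And>n. 0 \<le> u n"
  shows "real q * u k \<le> u (q * k)"
proof (induction q)
  case (Suc q)
  then show ?case using super[of k "q * k"] by (simp add: algebra_simps)
qed (simp add: nonneg)

text \<open>The limit is the supremum of the quotients. Division of \<open>n\<close> by
  \<open>k\<close> with remainder gives \<open>u n \<ge> (n / k - 1) * u k\<close>, so a nearly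
  optimal \<open>k\<close> pulls all late quotients up to the supremum.\<close>

lemma superadditive_convergent:
  fixes u :: "nat \<Rightarrow> real" and C :: real
  assumes super: "\<And>m n. u m + u n \<le> u (m + n)" and nonneg: "\<And>n. 0 \<le> u n"
    and bound: "\<And>n. u n \<le> C * real n"
  shows "convergent (\<lambda>n. u n / n)"
proof -
  define L where "L = (SUP n\<in>{1..}. u n / n)"
  have bdd: "bdd_above ((\<lambda>n. u n / n) ` {1..})"
    using bound by (intro bdd_aboveI[of _ C]) (auto simp: divide_le_eq)
  have "(\<lambda>n. u n / n) \<longlonglongrightarrow> L"
  proof (rule LIMSEQ_I)
    fix e :: real assume e: "0 < e"
    have "\<exists>k\<in>{1..}. L - e / 2 < u k / k"
      using less_cSUP_iff[OF _ bdd, of "L - e / 2"] e by (auto simp: L_def)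
    then obtain k where k: "1 \<le> k" "L - e / 2 < u k / k" by auto
    \<comment> \<open>\<open>N\<close> makes the remainder loss \<open>u k / n\<close> smaller than
      \<open>e / 2\<close>.\<close>
    obtain N where N: "2 * u k / e < real N" using reals_Archimedean2 by blast
    have "norm (u n / n - L) < e" if n: "max 1 N \<le> n" for n
    proof -
      have n1: "1 \<le> n" and nN: "2 * u k / e < n" using n N by (auto intro: less_le_trans)
      have "u n / n \<le> L" unfolding L_def using n1 by (intro cSUP_upper bdd) auto
      moreover have "u k / k - u k / n \<le> u n / n"
      proof -
        have "real n = real (n div k) * k + real (n mod k)" by (metis div_mult_mod_eq of_nat_add of_nat_mult)
        moreover have "real (n mod k) \<le> k" using k(1) by (intro of_nat_mono less_imp_le) simp
        ultimately have "real n / k - 1 \<le> real (n div k)" using k(1) by (simp add: field_simps)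
        then have "(real n / k - 1) * u k \<le> real (n div k) * u k" by (intro mult_right_mono nonneg)
        also have "\<dots> \<le> u (n div k * k)" by (rule superadditive_mult[OF super nonneg])
        also have "\<dots> \<le> u n" using super[of "n div k * k" "n mod k"] nonneg[of "n mod k"] by simp
        finally have "(real n / k - 1) * u k / n \<le> u n / n" by (intro divide_right_mono) auto
        moreover have "(real n / k - 1) * u k / n = u k / k - u k / n"
          using n1 k(1) by (simp add: field_simps)
        ultimately show ?thesis by simp
      qed
      moreover have "u k / n < e / 2" using nN n1 e by (simp add: field_simps)
      ultimately show ?thesis using k(2) by (simp add: abs_less_iff)
    qed
    then show "\<exists>no. \<forall>n\<ge>no. norm (u n / n - L) < e" by blast
  qed
  then show ?thesis by (auto simp: convergent_def)
qed

text \<open>Covers both notions: \<open>r\<close> true gives recovering pairs, while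
  \<open>r\<close> false restricts to \<open>B = B'\<close>, respectively \<open>A = A'\<close>, as
  in cancellative pairs. The product construction and the convergence are thus proved once.\<close>

definition separated_pair :: "bool \<Rightarrow> 'a set \<Rightarrow> 'a set set \<Rightarrow> 'a set set \<Rightarrow> bool" where
  "separated_pair r X \<A> \<B> \<longleftrightarrow> \<A> \<subseteq> Pow X \<and> \<B> \<subseteq> Pow X \<and>
    (\<forall>A\<in>\<A>. \<forall>A'\<in>\<A>. \<forall>B\<in>\<B>. \<forall>B'\<in>\<B>.
      ((r \<or> B = B') \<and> A - B = A' - B' \<longrightarrow> A = A') \<and>
      ((r \<or> A = A') \<and> B - A = B' - A' \<longrightarrow> B = B'))"

lemma recovering_pair_separated: "recovering_pair = separated_pair True"
  by (intro ext) (simp add: recovering_pair_def separated_pair_def)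

lemma cancellative_pair_separated: "cancellative_pair = separated_pair False"
proof (intro ext iffI)
  fix X :: "'a set" and \<A> \<B>
  assume "cancellative_pair X \<A> \<B>"
  note c = this[unfolded cancellative_pair_def]
  note cancel = c[THEN conjunct2, THEN conjunct2, rule_format]
  show "separated_pair False X \<A> \<B>"
    unfolding separated_pair_def
  proof (intro conjI ballI)
    show "\<A> \<subseteq> Pow X" "\<B> \<subseteq> Pow X" using c by simp_all
    fix A A' B B' assume mem: "A \<in> \<A>" "A' \<in> \<A>" "B \<in> \<B>" "B' \<in> \<B>"
    have *: "(False \<or> b) \<and> p \<longrightarrow> q" if "b \<Longrightarrow> p \<Longrightarrow> q" for b p q
      using that by blast
    show "(False \<or> B = B') \<and> A - B = A' - B' \<longrightarrow> A = A'"
      by (rule *) (use cancel[OF mem, THEN conjunct1] in simp)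
    show "(False \<or> A = A') \<and> B - A = B' - A' \<longrightarrow> B = B'"
      by (rule *) (use cancel[OF mem, THEN conjunct2] in simp)
  qed
next
  fix X :: "'a set" and \<A> \<B>
  assume "separated_pair False X \<A> \<B>"
  note s = this[unfolded separated_pair_def]
  note sep = s[THEN conjunct2, THEN conjunct2, rule_format]
  show "cancellative_pair X \<A> \<B>"
    unfolding cancellative_pair_def
  proof (intro conjI ballI)
    show "\<A> \<subseteq> Pow X" "\<B> \<subseteq> Pow X" using s by simp_all
    fix A A' B B' assume mem: "A \<in> \<A>" "A' \<in> \<A>" "B \<in> \<B>" "B' \<in> \<B>"
    show "A - B = A' - B \<longrightarrow> A = A'" using sep[OF mem(1,2,3,3)] by simp
    show "B - A = B' - A \<longrightarrow> B = B'" using sep[OF mem(1,1,3,4)] by simp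
  qed
qed

section \<open>Products of pairs on consecutive blocks\<close>

definition juxtapose :: "nat \<Rightarrow> nat set \<Rightarrow> nat set \<Rightarrow> nat set" where
  "juxtapose m A A' = A \<union> (+) m ` A'"

lemma juxtapose_eq_iff:
  assumes "A \<subseteq> {1..m}" "B \<subseteq> {1..m}" "A' \<subseteq> {1..n}" "B' \<subseteq> {1..n}"
  shows "juxtapose m A A' = juxtapose m B B' \<longleftrightarrow> A = B \<and> A' = B'"
proof
  have left: "juxtapose m C C' \<inter> {1..m} = C" if "C \<subseteq> {1..m}" "C' \<subseteq> {1..n}" for C C'
    using that by (fastforce simp: juxtapose_def)
  have right: "{i. 1 \<le> i \<and> m + i \<in> juxtapose m C C'} = C'" if "C \<subseteq> {1..m}" "C' \<subseteq> {1..n}" for C C'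
    using that by (fastforce simp: juxtapose_def)
  assume eq: "juxtapose m A A' = juxtapose m B B'"
  have "A = B" using left[of A A'] left[of B B'] assms eq by simp
  moreover have "A' = B'" using right[of A A'] right[of B B'] assms eq by simp
  ultimately show "A = B \<and> A' = B'" ..
qed simp

lemma juxtapose_diff:
  assumes "A \<subseteq> {1..m}" "B \<subseteq> {1..m}" "A' \<subseteq> {1..n}" "B' \<subseteq> {1..n}"
  shows "juxtapose m A A' - juxtapose m B B' = juxtapose m (A - B) (A' - B')"
proof -
  have disj: "C \<inter> (+) m ` D = {}" if C: "C \<subseteq> {1..m}" and D: "D \<subseteq> {1..n}" for C D
  proof -
    have "C \<inter> (+) m ` D \<subseteq> {1..m} \<inter> (+) m ` {1..n}" by (rule Int_mono[OF C image_mono[OF D]])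
    also have "\<dots> = {}" by auto
    finally show ?thesis by simp
  qed
  have "(A \<union> P) - (B \<union> Q) = (A - B) \<union> (P - Q)" if "A \<inter> Q = {}" "B \<inter> P = {}" for P Q
    using that by blast
  then show ?thesis
    unfolding juxtapose_def image_set_diff[OF inj_on_add] using disj assms by simp
qed

lemma juxtapose_diff_eq_iff:
  assumes "A \<subseteq> {1..m}" "B \<subseteq> {1..m}" "C \<subseteq> {1..m}" "D \<subseteq> {1..m}"
    and "A' \<subseteq> {1..n}" "B' \<subseteq> {1..n}" "C' \<subseteq> {1..n}" "D' \<subseteq> {1..n}"
  shows "juxtapose m A A' - juxtapose m B B' = juxtapose m C C' - juxtapose m D D' \<longleftrightarrow>
    A - B = C - D \<and> A' - B' = C' - D'"
proof -
  have "A - B \<subseteq> {1..m}" "C - D \<subseteq> {1..m}" "A' - B' \<subseteq> {1..n}" "C' - D' \<subseteq> {1..n}"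
    using assms(1,3,5,7) by blast+
  then show ?thesis
    unfolding juxtapose_diff[OF assms(1,2,5,6)] juxtapose_diff[OF assms(3,4,7,8)] by (rule juxtapose_eq_iff)
qed

definition juxtapose_families :: "nat \<Rightarrow> nat set set \<Rightarrow> nat set set \<Rightarrow> nat set set" where
  "juxtapose_families m \<A> \<A>' = (\<lambda>(A, A'). juxtapose m A A') ` (\<A> \<times> \<A>')"

lemma juxtapose_familiesE:
  assumes "S \<in> juxtapose_families m \<A> \<A>'"
  obtains A A' where "S = juxtapose m A A'" "A \<in> \<A>" "A' \<in> \<A>'"
  using assms by (auto simp: juxtapose_families_def)

lemma card_juxtapose_families:
  assumes "\<A> \<subseteq> Pow {1..m}" "\<A>' \<subseteq> Pow {1..n}"
  shows "card (juxtapose_families m \<A> \<A>') = card \<A> * card \<A>'"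
proof -
  have inj: "A = B \<and> A' = B'"
    if "A \<in> \<A>" "A' \<in> \<A>'" "B \<in> \<A>" "B' \<in> \<A>'" "juxtapose m A A' = juxtapose m B B'" for A A' B B'
  proof -
    have "A \<subseteq> {1..m}" "B \<subseteq> {1..m}" "A' \<subseteq> {1..n}" "B' \<subseteq> {1..n}" using that(1-4) assms by auto
    then show ?thesis using that(5) by (rule juxtapose_eq_iff[THEN iffD1])
  qed
  have "inj_on (\<lambda>(A, A'). juxtapose m A A') (\<A> \<times> \<A>')"
  proof (rule inj_onI)
    fix x y
    assume "x \<in> \<A> \<times> \<A>'" "y \<in> \<A> \<times> \<A>'" "(case x of (A, A') \<Rightarrow> juxtapose m A A') = (case y of (A, A') \<Rightarrow> juxtapose m A A')"
    then show "x = y"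
      using inj[of "fst x" "snd x" "fst y" "snd y"] by (simp add: case_prod_beta mem_Times_iff prod_eq_iff)
  qed
  then show ?thesis unfolding juxtapose_families_def by (simp add: card_image card_cartesian_product)
qed

text \<open>Equality of sets and of differences can be tested separately on the two blocks, so each
  premise splits into premises for the factors.\<close>

lemma separated_pair_juxtapose:
  assumes "separated_pair r {1..m} \<A> \<B>" "separated_pair r {1..n} \<A>' \<B>'"
  shows "separated_pair r {1..m + n} (juxtapose_families m \<A> \<A>') (juxtapose_families m \<B> \<B>')"
proof -
  note d1 = assms(1)[unfolded separated_pair_def] and d2 = assms(2)[unfolded separated_pair_def]
  note sub1 = d1[THEN conjunct1] d1[THEN conjunct2, THEN conjunct1]
  note sub2 = d2[THEN conjunct1] d2[THEN conjunct2, THEN conjunct1]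
  note sep1 = d1[THEN conjunct2, THEN conjunct2, THEN bspec, THEN bspec, THEN bspec, THEN bspec]
  note sep2 = d2[THEN conjunct2, THEN conjunct2, THEN bspec, THEN bspec, THEN bspec, THEN bspec]
  have sub: "juxtapose_families m \<C> \<C>' \<subseteq> Pow {1..m + n}" if "\<C> \<subseteq> Pow {1..m}" "\<C>' \<subseteq> Pow {1..n}" for \<C> \<C>'
  proof
    fix S assume "S \<in> juxtapose_families m \<C> \<C>'"
    then obtain C C' where "S = juxtapose m C C'" "C \<in> \<C>" "C' \<in> \<C>'" by (rule juxtapose_familiesE)
    moreover from this have "C \<subseteq> {1..m}" "C' \<subseteq> {1..n}" using that by auto
    ultimately show "S \<in> Pow {1..m + n}" by (auto simp: juxtapose_def)
  qed
  \<comment> \<open>When \<open>r\<close> is false, the equality of the sets that are held fixed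
    also splits, into \<open>b1\<close> and \<open>b2\<close>.\<close>
  have combine: "(r \<or> (b1 \<and> b2)) \<and> (p1 \<and> p2) \<longrightarrow> q1 \<and> q2"
    if "(r \<or> b1) \<and> p1 \<longrightarrow> q1" "(r \<or> b2) \<and> p2 \<longrightarrow> q2" for b1 b2 p1 p2 q1 q2
    using that by blast
  show ?thesis
    unfolding separated_pair_def
  proof (intro conjI ballI sub sub1 sub2)
    fix S S' T T'
    assume S: "S \<in> juxtapose_families m \<A> \<A>'" and S': "S' \<in> juxtapose_families m \<A> \<A>'"
      and T: "T \<in> juxtapose_families m \<B> \<B>'" and T': "T' \<in> juxtapose_families m \<B> \<B>'"
    obtain A1 A2 where A: "S = juxtapose m A1 A2" "A1 \<in> \<A>" "A2 \<in> \<A>'" by (rule juxtapose_familiesE[OF S])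
    obtain C1 C2 where C: "S' = juxtapose m C1 C2" "C1 \<in> \<A>" "C2 \<in> \<A>'" by (rule juxtapose_familiesE[OF S'])
    obtain B1 B2 where B: "T = juxtapose m B1 B2" "B1 \<in> \<B>" "B2 \<in> \<B>'" by (rule juxtapose_familiesE[OF T])
    obtain D1 D2 where D: "T' = juxtapose m D1 D2" "D1 \<in> \<B>" "D2 \<in> \<B>'" by (rule juxtapose_familiesE[OF T'])
    have subs: "A1 \<subseteq> {1..m}" "C1 \<subseteq> {1..m}" "B1 \<subseteq> {1..m}" "D1 \<subseteq> {1..m}"
      "A2 \<subseteq> {1..n}" "C2 \<subseteq> {1..n}" "B2 \<subseteq> {1..n}" "D2 \<subseteq> {1..n}"
      using A(2,3) B(2,3) C(2,3) D(2,3) sub1 sub2 by auto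
    note iffs = juxtapose_eq_iff[OF subs(1,2,5,6)] juxtapose_eq_iff[OF subs(3,4,7,8)]
      juxtapose_diff_eq_iff[OF subs(1,3,2,4,5,7,6,8)] juxtapose_diff_eq_iff[OF subs(3,1,4,2,7,5,8,6)]
    show "(r \<or> T = T') \<and> S - T = S' - T' \<longrightarrow> S = S'"
      unfolding A(1) B(1) C(1) D(1) iffs
      by (rule combine[OF sep1[THEN conjunct1] sep2[THEN conjunct1]]) fact+
    show "(r \<or> S = S') \<and> T - S = T' - S' \<longrightarrow> T = T'"
      unfolding A(1) B(1) C(1) D(1) iffs
      by (rule combine[OF sep1[THEN conjunct2] sep2[THEN conjunct2]]) fact+
  qed
qed

section \<open>Existence of the limits\<close>

definition pair_sizes :: "bool \<Rightarrow> nat \<Rightarrow> nat set" where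
  "pair_sizes r n = {card \<A> * card \<B> | \<A> \<B>. separated_pair r {1..n} \<A> \<B>}"

lemma finite_pair_sizes: "finite (pair_sizes r n)"
proof (rule finite_subset)
  show "pair_sizes r n \<subseteq> (\<lambda>(\<A>, \<B>). card \<A> * card \<B>) ` (Pow (Pow {1..n}) \<times> Pow (Pow {1..n}))"
    unfolding pair_sizes_def separated_pair_def by fast
qed simp

lemma one_in_pair_sizes: "1 \<in> pair_sizes r n"
  unfolding pair_sizes_def
  by (intro CollectI exI[of _ "{{}}"]) (simp add: separated_pair_def)

lemma pair_sizes_le: "k \<in> pair_sizes r n \<Longrightarrow> k \<le> 4 ^ n"
proof -
  assume "k \<in> pair_sizes r n"
  then obtain \<A> \<B> where "k = card \<A> * card \<B>" and sep: "separated_pair r {1..n} \<A> \<B>"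
    unfolding pair_sizes_def by blast
  moreover have "\<A> \<subseteq> Pow {1..n}" "\<B> \<subseteq> Pow {1..n}" using sep by (simp_all add: separated_pair_def)
  moreover from this have "card \<A> \<le> card (Pow {1..n})" "card \<B> \<le> card (Pow {1..n})"
    by (intro card_mono; simp)+
  ultimately have "k \<le> 2 ^ n * 2 ^ n" by (simp add: card_Pow mult_mono)
  then show ?thesis by (simp flip: power_mult_distrib)
qed

lemma pair_sizes_mult:
  assumes "k \<in> pair_sizes r m" "l \<in> pair_sizes r n"
  shows "k * l \<in> pair_sizes r (m + n)"
proof -
  obtain \<A> \<B> where 1: "k = card \<A> * card \<B>" "separated_pair r {1..m} \<A> \<B>"
    using assms(1) unfolding pair_sizes_def by blast
  obtain \<A>' \<B>' where 2: "l = card \<A>' * card \<B>'" "separated_pair r {1..n} \<A>' \<B>'"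
    using assms(2) unfolding pair_sizes_def by blast
  have "\<A> \<subseteq> Pow {1..m}" "\<B> \<subseteq> Pow {1..m}" "\<A>' \<subseteq> Pow {1..n}" "\<B>' \<subseteq> Pow {1..n}"
    using 1(2) 2(2) by (simp_all add: separated_pair_def)
  then have "k * l = card (juxtapose_families m \<A> \<A>') * card (juxtapose_families m \<B> \<B>')"
    by (simp add: card_juxtapose_families 1(1) 2(1))
  then show ?thesis
    using separated_pair_juxtapose[OF 1(2) 2(2)] unfolding pair_sizes_def by blast
qed

definition rate :: "bool \<Rightarrow> nat \<Rightarrow> real" where
  "rate r n = Max {real (card \<A> * card \<B>) powr (1 / real n) | \<A> \<B>. separated_pair r {1..n} \<A> \<B>}"

lemma rate_eq: "rate r n = real (Max (pair_sizes r n)) powr (1 / real n)"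
proof -
  have "rate r n = Max ((\<lambda>k. real k powr (1 / real n)) ` pair_sizes r n)"
    unfolding rate_def pair_sizes_def by (rule arg_cong[of _ _ Max]) blast
  also have "\<dots> = real (Max (pair_sizes r n)) powr (1 / real n)"
  proof (rule Max_eqI)
    show "real (Max (pair_sizes r n)) powr (1 / real n) \<in> (\<lambda>k. real k powr (1 / real n)) ` pair_sizes r n"
      using Max_in[OF finite_pair_sizes] one_in_pair_sizes by (intro imageI) blast
  qed (auto intro!: powr_mono2 Max_ge simp: finite_pair_sizes)
  finally show ?thesis .
qed

text \<open>Logarithms of the maxima are superadditive by the product construction, nonnegative
  because 1 is attained, and at most \<open>n * ln 4\<close>.\<close>

lemma rate_convergent: "convergent (rate r)"
proof -
  define u where "u n = ln (Max (pair_sizes r n))" for n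
  have M: "1 \<le> Max (pair_sizes r n)" "Max (pair_sizes r n) \<in> pair_sizes r n" for n
    using Max_ge[OF finite_pair_sizes one_in_pair_sizes, of r n] Max_in[OF finite_pair_sizes, of r n]
      one_in_pair_sizes[of r n] by auto
  have "convergent (\<lambda>n. u n / n)"
  proof (rule superadditive_convergent)
    show "u m + u n \<le> u (m + n)" for m n
    proof -
      have "Max (pair_sizes r m) * Max (pair_sizes r n) \<le> Max (pair_sizes r (m + n))"
        by (intro Max_ge finite_pair_sizes pair_sizes_mult M)
      then have "real (Max (pair_sizes r m)) * real (Max (pair_sizes r n)) \<le> Max (pair_sizes r (m + n))"
        by (simp flip: of_nat_mult)
      then have "ln (real (Max (pair_sizes r m)) * real (Max (pair_sizes r n))) \<le> u (m + n)"
        unfolding u_def using M(1)[of m] M(1)[of n] M(1)[of "m + n"] by (subst ln_le_cancel_iff) auto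
      then show ?thesis using M(1)[of m] M(1)[of n] by (simp add: u_def ln_mult_pos)
    qed
    show "0 \<le> u n" for n using M(1)[of n] by (simp add: u_def)
    show "u n \<le> ln 4 * n" for n
    proof -
      have "real (Max (pair_sizes r n)) \<le> 4 ^ n"
        using pair_sizes_le[OF M(2)[of n]] by (simp flip: of_nat_le_iff)
      then have "u n \<le> ln (4 ^ n)"
        unfolding u_def using M(1)[of n] by (subst ln_le_cancel_iff) auto
      then show ?thesis by (simp add: ln_realpow mult.commute)
    qed
  qed
  then obtain L where "(\<lambda>n. u n / n) \<longlonglongrightarrow> L" by (auto simp: convergent_def)
  then have "(\<lambda>n. exp (u n / n)) \<longlonglongrightarrow> exp L" by (rule tendsto_exp)
  \<comment> \<open>This includes \<open>n = 0\<close>, where both sides are 1 because division by 0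
    gives 0.\<close>
  moreover have "exp (u n / n) = rate r n" for n
    using M(1)[of n] by (simp add: rate_eq powr_def u_def)
  ultimately show ?thesis by (auto simp: convergent_def)
qed

section \<open>Comparison of the two rates\<close>

lemma rate_tendsto: "rate True \<longlonglongrightarrow> mu_rec" "rate False \<longlonglongrightarrow> mu_can"
  using rate_convergent unfolding convergent_LIMSEQ_iff mu_rec_def mu_can_def
    recovering_pair_separated cancellative_pair_separated rate_def[abs_def] by auto

text \<open>Using the same family twice squares \<open>3/2\<close>; the polynomial loss disappears
  in the \<open>n\<close>-th root.\<close>

lemma mu_can_ge: "9/4 \<le> mu_can"
proof (rule LIMSEQ_le)
  have "(\<lambda>n. (3/2 / (root n 8 * root n n))\<^sup>2) \<longlonglongrightarrow> (3/2 / (1 * 1))\<^sup>2"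
    by (intro tendsto_intros LIMSEQ_root LIMSEQ_root_const) auto
  then show "(\<lambda>n. (3/2 / (root n 8 * root n n))\<^sup>2) \<longlonglongrightarrow> 9/4" by (simp add: power2_eq_square)
  show "rate False \<longlonglongrightarrow> mu_can" by (rule rate_tendsto)
  have "(3/2 / (root n 8 * root n n))\<^sup>2 \<le> rate False n" if n: "1 \<le> n" for n
  proof -
    obtain \<G> where G: "cancellative_pair {1..n} \<G> \<G>" "(3/2) ^ n / (4 * (real n + 1)) \<le> real (card \<G>)"
      using cancellative_family_three_halves by blast
    \<comment> \<open>For \<open>n \<ge> 1\<close>, \<open>4 * (n + 1) \<le> 8 * n\<close>; the root
      of the latter splits into \<open>root n 8\<close> and \<open>root n n\<close>.\<close>
    have "(3/2 :: real) ^ n / (8 * real n) \<le> (3/2) ^ n / (4 * (real n + 1))"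
      using n by (intro divide_left_mono) auto
    with G(2) have "((3/2) ^ n / (8 * real n))\<^sup>2 \<le> (real (card \<G>))\<^sup>2"
      by (intro power_mono) auto
    also have "\<dots> = real (card \<G> * card \<G>)" by (simp add: power2_eq_square)
    also have "\<dots> \<le> Max (pair_sizes False n)"
      using G(1) unfolding of_nat_le_iff cancellative_pair_separated
      by (intro Max_ge finite_pair_sizes) (auto simp: pair_sizes_def)
    finally have le: "((3/2) ^ n / (8 * real n))\<^sup>2 \<le> Max (pair_sizes False n)" .
    have "(3/2 / (root n 8 * root n n))\<^sup>2 = root n (((3/2) ^ n / (8 * real n))\<^sup>2)"
    proof -
      have "root n ((3/2) ^ n) = 3/2" using n by (intro real_root_power_cancel) auto
      then show ?thesis
        using n real_root_power[of n "(3/2) ^ n / (8 * real n)" 2]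
        by (simp only: real_root_divide real_root_mult)
    qed
    also have "\<dots> = ((3/2) ^ n / (8 * real n))\<^sup>2 powr (1 / real n)"
      using n by (intro root_powr_inverse) auto
    also have "\<dots> \<le> rate False n"
      unfolding rate_eq using le by (intro powr_mono2) auto
    finally show ?thesis .
  qed
  then show "\<exists>N. \<forall>n\<ge>N. (3/2 / (root n 8 * root n n))\<^sup>2 \<le> rate False n" by blast
qed

lemma mu_rec_le: "mu_rec \<le> 2.2499"
proof (rule LIMSEQ_le_const2[OF rate_tendsto(1)])
  have "rate True n \<le> 2.2499" if n: "1 \<le> n" for n
  proof -
    have "Max (pair_sizes True n) \<in> pair_sizes True n"
      using Max_in[OF finite_pair_sizes] one_in_pair_sizes by blast
    then obtain \<A> \<B> where "recovering_pair {1..n} \<A> \<B>" "Max (pair_sizes True n) = card \<A> * card \<B>"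
      unfolding pair_sizes_def recovering_pair_separated by blast
    then have "real (Max (pair_sizes True n)) \<le> 2.2499 ^ n"
      using recovering_pair_card_le[of "{1..n}" \<A> \<B>] by simp
    then have "rate True n \<le> (2.2499 ^ n) powr (1 / real n)"
      unfolding rate_eq by (intro powr_mono2) auto
    also have "\<dots> = 2.2499"
      using n by (simp add: powr_powr flip: powr_realpow)
    finally show ?thesis .
  qed
  then show "\<exists>N. \<forall>n\<ge>N. rate True n \<le> 2.2499" by blast
qed

theorem theorem1p3:
  "(let \<alpha> = 0.27 :: real; \<theta> = 2.222 :: real in
      \<forall>(X :: 'a set) n \<A> \<B>. finite X \<longrightarrow> card X = n \<longrightarrow> recovering_pair X \<A> \<B> \<longrightarrow>
        real (card \<A>) * real (card \<B>) \<le> (max 2.2499 (\<theta> powr \<alpha> * mu_can powr (1 - \<alpha>))) ^ n)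
   \<and> mu_rec < mu_can"
proof -
  \<comment> \<open>The bound comes from the first entry of the maximum, whatever the second entry
    \<open>y\<close> is.\<close>
  have "real (card \<A>) * real (card \<B>) \<le> (max 2.2499 y) ^ n"
    if "finite X" "card X = n" "recovering_pair X \<A> \<B>" for X :: "'a set" and n \<A> \<B> and y :: real
  proof -
    have "real (card \<A>) * real (card \<B>) \<le> 2.2499 ^ n"
      using recovering_pair_card_le[OF that(1,3)] that(2) by simp
    also have "\<dots> \<le> (max 2.2499 y) ^ n" by (intro power_mono) auto
    finally show ?thesis .
  qed
  \<comment> \<open>The strict inequality rests on \<open>2.2499 < 9/4\<close>.\<close>
  then show ?thesis
    using mu_rec_le mu_can_ge by (simp add: Let_def)
qed

end
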